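(* For each $n\in\{0,1,2,3\}$, the image of the map $\sigma_n:P_n(C)\to H_n(0)$ is $\Sigma_n$, where $H_n(0)$ is identified with $H_n(1)$ via $Y\mapsto Y+\frac13I$; that is, $\sigma_n(P_n(C))=\{X-\frac13I:X\in\Sigma_n\}$.
   Context: Let $A_0=\mathbb R$, $A_1=\mathbb C$, $A_2=\mathbb H$, $A_3=\mathbb O$ be the normed real division algebras. $H_n$ is the real vector space of $3\times3$ Hermitian matrices over $A_n$ ($\bar x_{ij}=x_{ji}$), with trace $\mathrm{tr}$ and Jordan product $X\circ Y=\frac12(XY+YX)$; the resulting Jordan algebra is $J_n$. $I$ is the unit matrix and $H_n(c)=\{X\in H_n:\mathrm{tr}\,X=c\}$; $H_n(0)$ is regarded as the affine space $H_n(1)$ with $\frac13I$ as origin. Every $X\in H_n$ can be brought by $\mathrm{Aut}(J_n)$ to real diagonal form $\mathrm{Diag}(\lambda_1,\lambda_2,\lambda_3)$; $\lambda_1\le\lambda_2\le\lambda_3$ are the eigenvalues of $X$. $\Lambda_n^+\subset H_n(1)$ is the set of matrices with $\lambda_1>0$ (positive definite), and $\Sigma_n$ is its boundary; so $\Sigma_n=\{X\in H_n(1):0=\lambda_1\le\lambda_2\le\lambda_3\}$. The complexified projective plane. Let $G_n=SO(3),SU(3),Sp(3),F_4$ for $n=0,1,2,3$, acting on $H_n$ with image the identity component of $\mathrm{Aut}(J_n)$, let $H_n(C)=H_n\otimes_{\mathbb R}\mathbb C$, and for $X\in H_n$ let $L_X:Y\mapsto X\circ Y$. The compact group $\hat G_n$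 is $SU(3)$, $SU(3)\times SU(3)$, $SU(6)$, $E_6$ for $n=0,1,2,3$; it acts on $H_n(C)$ so that its Lie algebra is $L(\hat G_n)=L(G_n)\oplus H_n(0)$, where $L(G_n)=\mathrm{Der}(J_n)$ and $X\in H_n(0)$ corresponds to the operator $iL_X$ on $H_n(C)$. $P_n(C)$ is the $\hat G_n$-orbit of $[\mathrm{Diag}(1,0,0)]$ in the complex projective space of $H_n(C)$. It is embedded $\hat G_n$-equivariantly in $L(\hat G_n)$ as the adjoint orbit of $E_0=\mathrm{Diag}(2/3,-1/3,-1/3)\in H_n(0)\subset L(\hat G_n)$, the point $g[\mathrm{Diag}(1,0,0)]$ corresponding to $\mathrm{Ad}(g)E_0$. The map $\sigma_n:P_n(C)\to H_n(0)$ is the restriction to this orbit of the projection $L(G_n)\oplus H_n(0)\to H_n(0)$. *)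

theory Defs
  imports "HOL-Analysis.Analysis"
begin

section \<open>The four normed division algebras\<close>

text \<open>
  Unital real algebras with involution; multiplication need not be associative.
  The real number \<open>r\<close> is embedded as \<open>r *\<^sub>R 1\<close>.
\<close>

class conj_algebra = real_inner + one + times +
  fixes aconj :: "'a \<Rightarrow> 'a"
  assumes alg_add_left: "(x + y) * z = x * z + y * z"
    and alg_add_right: "z * (x + y) = z * x + z * y"
    and alg_scaleR_left: "(r *\<^sub>R x) * y = r *\<^sub>R (x * y)"
    and alg_scaleR_right: "x * (r *\<^sub>R y) = r *\<^sub>R (x * y)"
    and alg_one_left: "1 * x = x"
    and alg_one_right: "x * 1 = x"
    and aconj_add: "aconj (x + y) = aconj x + aconj y"
    and aconj_scaleR: "aconj (r *\<^sub>R x) = r *\<^sub>R aconj x"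
    and aconj_conj: "aconj (aconj x) = x"
    and aconj_mult: "aconj (x * y) = aconj y * aconj x"
    and aconj_one: "aconj 1 = 1"

lemma aconj_zero: "aconj (0 :: 'a::conj_algebra) = 0"
  using aconj_scaleR[of 0 "0 :: 'a"] by simp

lemma aconj_uminus: "aconj (- x :: 'a::conj_algebra) = - aconj x"
  using aconj_scaleR[of "-1" x] by simp

lemma aconj_diff: "aconj (x - y :: 'a::conj_algebra) = aconj x - aconj y"
  using aconj_add[of x "- y"] by (simp add: aconj_uminus)

lemma alg_minus_left: "(- x :: 'a::conj_algebra) * y = - (x * y)"
  using alg_scaleR_left[of "-1" x y] by simp

lemma alg_minus_right: "x * (- y :: 'a::conj_algebra) = - (x * y)"
  using alg_scaleR_right[of x "-1" y] by simp

lemma alg_diff_left: "(x - y :: 'a::conj_algebra) * z = x * z - y * z"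
  using alg_add_left[of x "- y" z] by (simp add: alg_minus_left)

lemma alg_diff_right: "z * (x - y :: 'a::conj_algebra) = z * x - z * y"
  using alg_add_right[of z x "- y"] by (simp add: alg_minus_right)

lemma aconj_sum: "aconj (sum f S :: 'a::conj_algebra) = (\<Sum>x\<in>S. aconj (f x))"
  by (induction S rule: infinite_finite_induct) (simp_all add: aconj_zero aconj_add)

instantiation real :: conj_algebra
begin

definition aconj_real :: "real \<Rightarrow> real" where "aconj_real x = x"

instance by standard (simp_all add: aconj_real_def algebra_simps)

end

instantiation complex :: conj_algebra
begin

definition aconj_complex :: "complex \<Rightarrow> complex" where "aconj_complex = cnj"

instance by standard (simp_all add: aconj_complex_def algebra_simps)

end

text \<open>Cayley--Dickson doubling: the pair \<open>(a, b)\<close> of complex numbers is the quaternion \<open>a + b j\<close>.\<close>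

typedef 'a cd = "UNIV :: ('a \<times> 'a) set"
  morphisms cd_pair CD by simp

setup_lifting type_definition_cd

instantiation cd :: (real_inner) real_inner
begin

lift_definition zero_cd :: "'a cd" is "0" .
lift_definition plus_cd :: "'a cd \<Rightarrow> 'a cd \<Rightarrow> 'a cd" is "(+)" .
lift_definition minus_cd :: "'a cd \<Rightarrow> 'a cd \<Rightarrow> 'a cd" is "(-)" .
lift_definition uminus_cd :: "'a cd \<Rightarrow> 'a cd" is "uminus" .
lift_definition scaleR_cd :: "real \<Rightarrow> 'a cd \<Rightarrow> 'a cd" is "(*\<^sub>R)" .
lift_definition inner_cd :: "'a cd \<Rightarrow> 'a cd \<Rightarrow> real" is "(\<bullet>)" .
lift_definition norm_cd :: "'a cd \<Rightarrow> real" is "norm" .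
lift_definition sgn_cd :: "'a cd \<Rightarrow> 'a cd" is "sgn" .
lift_definition dist_cd :: "'a cd \<Rightarrow> 'a cd \<Rightarrow> real" is "dist" .

definition uniformity_cd :: "('a cd \<times> 'a cd) filter" where
  "uniformity_cd = (INF e\<in>{0<..}. principal {(x, y). dist x y < e})"

definition open_cd :: "'a cd set \<Rightarrow> bool" where
  "open_cd U \<longleftrightarrow> (\<forall>x\<in>U. eventually (\<lambda>(x', y). x' = x \<longrightarrow> y \<in> U) uniformity)"

instance
proof
  fix x y z :: "'a cd" and r s :: real and U :: "'a cd set"
  show "x + y + z = x + (y + z)" "x + y = y + x" "0 + x = x" "- x + x = 0" "x - y = x + - y"
    by (transfer; simp)+
  show "r *\<^sub>R (x + y) = r *\<^sub>R x + r *\<^sub>R y" "(r + s) *\<^sub>R x = r *\<^sub>R x + s *\<^sub>R x"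
    "r *\<^sub>R s *\<^sub>R x = (r * s) *\<^sub>R x" "1 *\<^sub>R x = x"
    by (transfer; simp add: scaleR_add_right scaleR_add_left)+
  show "dist x y = norm (x - y)" by transfer (rule dist_norm)
  show "sgn x = inverse (norm x) *\<^sub>R x" by transfer (rule sgn_div_norm)
  show "x \<bullet> y = y \<bullet> x" by transfer (rule inner_commute)
  show "(x + y) \<bullet> z = x \<bullet> z + y \<bullet> z" by transfer (rule inner_add_left)
  show "(r *\<^sub>R x) \<bullet> y = r * (x \<bullet> y)" by transfer (rule inner_scaleR_left)
  show "0 \<le> x \<bullet> x" by transfer (rule inner_ge_zero)
  show "(x \<bullet> x = 0) = (x = 0)" by transfer (rule inner_eq_zero_iff)
  show "norm x = sqrt (x \<bullet> x)" by transfer (rule norm_eq_sqrt_inner)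
  show "uniformity = (INF e\<in>{0<..}. principal {(x::'a cd, y). dist x y < e})"
    by (rule uniformity_cd_def)
  show "open U = (\<forall>x\<in>U. eventually (\<lambda>(x', y). x' = x \<longrightarrow> y \<in> U) uniformity)"
    by (rule open_cd_def)
qed

end

instantiation cd :: (conj_algebra) conj_algebra
begin

lift_definition one_cd :: "'a cd" is "(1, 0)" .

lift_definition times_cd :: "'a cd \<Rightarrow> 'a cd \<Rightarrow> 'a cd" is
  "\<lambda>(a, b) (c, d). (a * c - aconj d * b, d * a + b * aconj c)" .

lift_definition aconj_cd :: "'a cd \<Rightarrow> 'a cd" is "\<lambda>(a, b). (aconj a, - b)" .

instance
proof
  fix x y z :: "'a cd" and r :: real
  note simps = alg_add_left alg_add_right alg_scaleR_left alg_scaleR_right alg_one_left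
    alg_one_right aconj_add aconj_scaleR aconj_conj aconj_mult aconj_one aconj_zero aconj_uminus
    aconj_diff alg_minus_left alg_minus_right alg_diff_left alg_diff_right
    scaleR_add_right scaleR_diff_right
  have zero: "0 * a = 0" "a * 0 = 0" for a :: 'a
    using alg_scaleR_left[of 0 0 a] alg_scaleR_right[of a 0 0] by simp_all
  show "(x + y) * z = x * z + y * z" "z * (x + y) = z * x + z * y"
    "(r *\<^sub>R x) * y = r *\<^sub>R (x * y)" "x * (r *\<^sub>R y) = r *\<^sub>R (x * y)"
    "1 * x = x" "x * 1 = x" "aconj (x + y) = aconj x + aconj y"
    "aconj (r *\<^sub>R x) = r *\<^sub>R aconj x" "aconj (aconj x) = x"
    "aconj (x * y) = aconj y * aconj x" "aconj (1 :: 'a cd) = 1"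
    by (transfer; auto simp: simps zero)+
qed

end

type_synonym quaternion = "complex cd"
type_synonym octonion = "quaternion cd"


section \<open>The Jordan algebras of Hermitian matrices\<close>

typedef (overloaded) 'a herm =
  "{X :: 'a::conj_algebra ^ 3 ^ 3. \<forall>i j. aconj (X $ i $ j) = X $ j $ i}"
  morphisms mat_of Herm
  by (rule exI[of _ 0]) (simp add: aconj_zero)

setup_lifting type_definition_herm

instantiation herm :: (conj_algebra) real_inner
begin

lift_definition zero_herm :: "'a herm" is "0" by (simp add: aconj_zero)
lift_definition plus_herm :: "'a herm \<Rightarrow> 'a herm \<Rightarrow> 'a herm" is "(+)" by (simp add: aconj_add)
lift_definition minus_herm :: "'a herm \<Rightarrow> 'a herm \<Rightarrow> 'a herm" is "(-)" by (simp add: aconj_diff)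
lift_definition uminus_herm :: "'a herm \<Rightarrow> 'a herm" is "uminus" by (simp add: aconj_uminus)
lift_definition scaleR_herm :: "real \<Rightarrow> 'a herm \<Rightarrow> 'a herm" is "(*\<^sub>R)" by (simp add: aconj_scaleR)
lift_definition inner_herm :: "'a herm \<Rightarrow> 'a herm \<Rightarrow> real" is "(\<bullet>)" .
lift_definition norm_herm :: "'a herm \<Rightarrow> real" is "norm" .
lift_definition sgn_herm :: "'a herm \<Rightarrow> 'a herm" is "sgn"
  by (simp add: sgn_div_norm aconj_scaleR)
lift_definition dist_herm :: "'a herm \<Rightarrow> 'a herm \<Rightarrow> real" is "dist" .

definition uniformity_herm :: "('a herm \<times> 'a herm) filter" where
  "uniformity_herm = (INF e\<in>{0<..}. principal {(x, y). dist x y < e})"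

definition open_herm :: "'a herm set \<Rightarrow> bool" where
  "open_herm U \<longleftrightarrow> (\<forall>x\<in>U. eventually (\<lambda>(x', y). x' = x \<longrightarrow> y \<in> U) uniformity)"

instance
proof
  fix x y z :: "'a herm" and r s :: real and U :: "'a herm set"
  show "x + y + z = x + (y + z)" "x + y = y + x" "0 + x = x" "- x + x = 0" "x - y = x + - y"
    by (transfer; simp)+
  show "r *\<^sub>R (x + y) = r *\<^sub>R x + r *\<^sub>R y" "(r + s) *\<^sub>R x = r *\<^sub>R x + s *\<^sub>R x"
    "r *\<^sub>R s *\<^sub>R x = (r * s) *\<^sub>R x" "1 *\<^sub>R x = x"
    by (transfer; simp add: scaleR_add_right scaleR_add_left)+
  show "dist x y = norm (x - y)" by transfer (rule dist_norm)
  show "sgn x = inverse (norm x) *\<^sub>R x" by transfer (rule sgn_div_norm)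
  show "x \<bullet> y = y \<bullet> x" by transfer (rule inner_commute)
  show "(x + y) \<bullet> z = x \<bullet> z + y \<bullet> z" by transfer (rule inner_add_left)
  show "(r *\<^sub>R x) \<bullet> y = r * (x \<bullet> y)" by transfer (rule inner_scaleR_left)
  show "0 \<le> x \<bullet> x" by transfer (rule inner_ge_zero)
  show "(x \<bullet> x = 0) = (x = 0)" by transfer (rule inner_eq_zero_iff)
  show "norm x = sqrt (x \<bullet> x)" by transfer (rule norm_eq_sqrt_inner)
  show "uniformity = (INF e\<in>{0<..}. principal {(x::'a herm, y). dist x y < e})"
    by (rule uniformity_herm_def)
  show "open U = (\<forall>x\<in>U. eventually (\<lambda>(x', y). x' = x \<longrightarrow> y \<in> U) uniformity)"
    by (rule open_herm_def)
qed

end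

text \<open>The library's matrix product needs an associative ring of coefficients.\<close>

definition mat_prod :: "('a::conj_algebra) ^ 3 ^ 3 \<Rightarrow> 'a ^ 3 ^ 3 \<Rightarrow> 'a ^ 3 ^ 3" where
  "mat_prod X Y = (\<chi> i j. \<Sum>k\<in>UNIV. X $ i $ k * Y $ k $ j)"

lift_definition jordan :: "('a::conj_algebra) herm \<Rightarrow> 'a herm \<Rightarrow> 'a herm" (infixl "\<circ>\<^sub>J" 70) is
  "\<lambda>X Y. (1/2) *\<^sub>R (mat_prod X Y + mat_prod Y X)"
  by (simp add: mat_prod_def aconj_scaleR aconj_add aconj_sum aconj_mult add.commute)

lift_definition Diag :: "real \<Rightarrow> real \<Rightarrow> real \<Rightarrow> ('a::conj_algebra) herm" is
  "\<lambda>a b c. \<chi> i j. if i = j then ((vector [a, b, c] :: real ^ 3) $ i) *\<^sub>R 1 else 0"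
  by (simp add: aconj_scaleR aconj_one aconj_zero)

abbreviation unit_mat :: "('a::conj_algebra) herm" where
  "unit_mat \<equiv> Diag 1 1 1"

definition tr :: "('a::conj_algebra) herm \<Rightarrow> 'a" where
  "tr X = (\<Sum>i\<in>UNIV. mat_of X $ i $ i)"

definition trace_slice :: "real \<Rightarrow> ('a::conj_algebra) herm set" where
  "trace_slice c = {X. tr X = c *\<^sub>R 1}"

definition jordan_aut :: "(('a::conj_algebra) herm \<Rightarrow> 'a herm) set" where
  "jordan_aut = {g. linear g \<and> bij g \<and> (\<forall>X Y. g (X \<circ>\<^sub>J Y) = g X \<circ>\<^sub>J g Y)}"

definition jordan_der :: "(('a::conj_algebra) herm \<Rightarrow> 'a herm) set" where
  "jordan_der = {D. linear D \<and> (\<forall>X Y. D (X \<circ>\<^sub>J Y) = D X \<circ>\<^sub>J Y + X \<circ>\<^sub>J D Y)}"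

definition eigenvalues :: "('a::conj_algebra) herm \<Rightarrow> real \<Rightarrow> real \<Rightarrow> real \<Rightarrow> bool" where
  "eigenvalues X l1 l2 l3 \<longleftrightarrow>
     l1 \<le> l2 \<and> l2 \<le> l3 \<and> (\<exists>g\<in>jordan_aut. g X = Diag l1 l2 l3)"

definition Lambda_pos :: "('a::conj_algebra) herm set" where
  "Lambda_pos = {X \<in> trace_slice 1. \<exists>l1 l2 l3. eigenvalues X l1 l2 l3 \<and> 0 < l1}"

text \<open>The boundary is taken inside the affine hyperplane of matrices of trace one.\<close>

definition Sigma_bd :: "('a::conj_algebra) herm set" where
  "Sigma_bd = top_of_set (trace_slice 1) frontier_of Lambda_pos"


section \<open>The complexified projective plane\<close>

text \<open>The pair \<open>(Y, Z)\<close> stands for \<open>Y + \<i> Z\<close> in the complexification.\<close>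

type_synonym 'a hermC = "'a herm \<times> 'a herm"

definition scaleC :: "complex \<Rightarrow> ('a::conj_algebra) hermC \<Rightarrow> 'a hermC" where
  "scaleC c u = (Re c *\<^sub>R fst u - Im c *\<^sub>R snd u, Re c *\<^sub>R snd u + Im c *\<^sub>R fst u)"

definition cextend :: "(('a::conj_algebra) herm \<Rightarrow> 'a herm) \<Rightarrow> 'a hermC \<Rightarrow> 'a hermC" where
  "cextend T u = (T (fst u), T (snd u))"

definition iL :: "('a::conj_algebra) herm \<Rightarrow> 'a hermC \<Rightarrow> 'a hermC" where
  "iL X u = scaleC \<i> (cextend (\<lambda>Y. X \<circ>\<^sub>J Y) u)"

text \<open>The Lie algebra of the compact group, as an algebra of operators on the complexification.\<close>

definition lie_hat :: "(('a::conj_algebra) hermC \<Rightarrow> 'a hermC) set" where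
  "lie_hat = {(\<lambda>u. cextend D u + iL X u) | D X. D \<in> jordan_der \<and> X \<in> trace_slice 0}"

definition op_exp :: "('v::real_normed_vector \<Rightarrow> 'v) \<Rightarrow> 'v \<Rightarrow> 'v" where
  "op_exp T v = (\<Sum>k. (1 / fact k) *\<^sub>R (T ^^ k) v)"

text \<open>
  The groups \<open>SU(3)\<close>, \<open>SU(3) \<times> SU(3)\<close>, \<open>SU(6)\<close>, \<open>E\<^sub>6\<close> are connected, so the image of each
  in the linear group of the complexification is generated by the exponentials of its Lie algebra.
  The kernel of the action also acts trivially on the Lie algebra of operators (by conjugation).
  No closure under inverses is needed, as \<open>exp (- T)\<close> is the inverse of \<open>exp T\<close>.
\<close>

inductive_set G_hat :: "(('a::conj_algebra) hermC \<Rightarrow> 'a hermC) set" where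
  G_hat_id: "id \<in> G_hat"
| G_hat_exp: "T \<in> lie_hat \<Longrightarrow> g \<in> G_hat \<Longrightarrow> op_exp T \<circ> g \<in> G_hat"

definition Ad :: "(('a::conj_algebra) hermC \<Rightarrow> 'a hermC) \<Rightarrow> ('a hermC \<Rightarrow> 'a hermC)
    \<Rightarrow> ('a hermC \<Rightarrow> 'a hermC)" where
  "Ad g T = g \<circ> T \<circ> inv g"

text \<open>Points of the complex projective space are complex lines through the origin.\<close>

definition proj_pt :: "('a::conj_algebra) hermC \<Rightarrow> 'a hermC set" where
  "proj_pt u = range (\<lambda>c. scaleC c u)"

definition base_pt :: "('a::conj_algebra) hermC set" where
  "base_pt = proj_pt (Diag 1 0 0, 0)"

definition PC :: "('a::conj_algebra) hermC set set" where
  "PC = {g ` base_pt | g. g \<in> G_hat}"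

definition E0 :: "('a::conj_algebra) herm" where
  "E0 = Diag (2/3) (-1/3) (-1/3)"

definition adjoint_embedding :: "('a::conj_algebra) hermC set \<Rightarrow> ('a hermC \<Rightarrow> 'a hermC)" where
  "adjoint_embedding p = (THE T. \<exists>g\<in>G_hat. p = g ` base_pt \<and> T = Ad g (iL E0))"

definition lie_proj :: "(('a::conj_algebra) hermC \<Rightarrow> 'a hermC) \<Rightarrow> 'a herm" where
  "lie_proj T = (THE X. X \<in> trace_slice 0 \<and>
     (\<exists>D\<in>jordan_der. T = (\<lambda>u. cextend D u + iL X u)))"

definition sigma_map :: "('a::conj_algebra) hermC set \<Rightarrow> 'a herm" where
  "sigma_map p = lie_proj (adjoint_embedding p)"

end

theory Submission
  imports Defs
begin

text \<open>
  The group \<open>G_hat\<close> preserves the Hermitian Jordan triple product on the complexification, and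
  \<open>\<i> L E0 = \<i> (ctrip e e - 1/3)\<close> for \<open>e = Diag 1 0 0\<close>. Hence \<open>Ad g (\<i> L E0) = \<i> (ctrip u u - 1/3)\<close> with
  \<open>u = g e = Y + \<i> Z\<close>, whose component in the traceless matrices is \<open>Y\<^sup>2 + Z\<^sup>2 - 1/3\<close>. The equation
  \<open>u\<^sup>2 = tr u u\<close>, inherited from \<open>e\<close>, provides a primitive idempotent annihilating both \<open>Y\<close> and \<open>Z\<close>, so
  that \<open>Y\<^sup>2 + Z\<^sup>2\<close> is positive semidefinite but singular. Conversely the exponential of
  \<open>2 \<theta> \<i> L F\<close>, with \<open>F\<close> the unit entry at \<open>(1,2)\<close>, takes \<open>e\<close> to a vector with
  \<open>Y\<^sup>2 + Z\<^sup>2 = Diag (cos\<^sup>2 \<theta>) (sin\<^sup>2 \<theta>) 0\<close>, and every boundary matrix is conjugate to one of this form.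

  Conjugation to diagonal form, by rotations with explicit infinitesimal generators, reduces the
  Jordan identity to diagonal matrices, where it is trivial.
\<close>

section \<open>Composition algebras\<close>

text \<open>Octonions forbid associative matrix calculus, and the four cases are treated at once:
  \<open>comp_alg\<close> keeps what survives for octonions, namely norm cancellation and adjoints
  of multiplications. \<open>G_hat\<close> is given by generators \<open>op_exp T\<close>, so
  invariance is checked infinitesimally on \<open>lie_hat\<close> and integrated by uniqueness for
  linear differential equations (\<open>op_exp_curve\<close>). In general \<open>iL X\<close>
  respects neither the Jordan product nor the unit; conjugation in the middle slot makes it a
  derivation of the triple product. The relation u^2 = tr(u) u comes from {e w e} = c e, c a scalar
  depending on w, by applying g at the preimage w of the unit matrix. \<open>Sigma_bd\<close> is
  defined through diagonal forms under arbitrary automorphisms; pairing with squares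
  (\<open>psd\<close>) turns this into inequalities that are stable under limits and under the
  diagonalizing group. The summand 1/3 reflects that \<open>E0\<close> is \<open>Diag 1 0 0\<close>
  minus a third of the unit.\<close>

class comp_alg = conj_algebra + euclidean_space +
  assumes real_part: "x + aconj x = (2 * (x \<bullet> 1)) *\<^sub>R 1"
    and conj_mult_cancel: "aconj x * (x * y) = (x \<bullet> x) *\<^sub>R y"
    and mult_conj_cancel: "(y * x) * aconj x = (x \<bullet> x) *\<^sub>R y"
    and inner_mult_left: "(x * y) \<bullet> z = y \<bullet> (aconj x * z)"

text \<open>Doubling loses one law at each stage: a commutative base has an associative double, an
  associative base a double satisfying only \<open>comp_alg\<close>. This places the quaternions in
  this class and the octonions in the previous one.\<close>

class assoc_comp_alg = comp_alg +
  assumes alg_assoc: "(x * y) * z = x * (y * z)"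

class comm_comp_alg = assoc_comp_alg +
  assumes alg_comm: "x * y = y * x"

instance real :: comm_comp_alg
  by standard (simp_all add: aconj_real_def algebra_simps)

instance complex :: comm_comp_alg
  by standard (simp_all add: aconj_complex_def inner_complex_def complex_eq_iff algebra_simps)

lemmas alg_simps = alg_add_left alg_add_right alg_scaleR_left alg_scaleR_right alg_one_left
  alg_one_right aconj_add aconj_scaleR aconj_conj aconj_mult aconj_one aconj_uminus
  aconj_diff alg_minus_left alg_minus_right alg_diff_left alg_diff_right

lemma alg_zero [simp]: "0 * a = 0" "a * 0 = 0" for a :: "'a::conj_algebra"
  using alg_scaleR_left[of 0 0 a] alg_scaleR_right[of a 0 0] by simp_all

declare aconj_zero [simp]

lemma one_nonzero: "(1 :: 'a::comp_alg) \<noteq> 0"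
proof
  assume "(1 :: 'a) = 0"
  then have "x = 0" for x :: 'a using alg_one_left[of x] by simp
  then show False using nonzero_Basis[OF SOME_Basis] by blast
qed

lemma conj_mult_self: "aconj x * x = (x \<bullet> x) *\<^sub>R (1 :: 'a::comp_alg)"
  using conj_mult_cancel[of x 1] by (simp add: alg_one_right)

lemma mult_conj_self: "x * aconj x = (x \<bullet> x) *\<^sub>R (1 :: 'a::comp_alg)"
  using mult_conj_cancel[of 1 x] by (simp add: alg_one_left)

lemma inner_one_one [simp]: "1 \<bullet> (1 :: 'a::comp_alg) = 1"
  using conj_mult_self[of "1 :: 'a"] one_nonzero[where 'a='a]
  by (simp add: aconj_one alg_one_left) (metis scaleR_cancel_right scaleR_one)

lemma inner_conj_self: "aconj x \<bullet> aconj x = x \<bullet> (x :: 'a::comp_alg)"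
  using conj_mult_self[of "aconj x"] mult_conj_self[of x] one_nonzero[where 'a='a]
  by (simp add: aconj_conj)

lemma inner_conj_conj: "aconj x \<bullet> aconj y = x \<bullet> (y :: 'a::comp_alg)"
  using inner_conj_self[of "x + y"] inner_conj_self[of x] inner_conj_self[of y]
  by (simp add: aconj_add inner_add_left inner_add_right inner_commute)

lemma inner_conj_left: "aconj x \<bullet> y = x \<bullet> aconj (y :: 'a::comp_alg)"
  using inner_conj_conj[of x "aconj y"] by (simp add: aconj_conj)

lemma inner_mult_right: "(x * y) \<bullet> z = x \<bullet> (z * aconj y)" for x :: "'a::comp_alg"
proof -
  have "(x * y) \<bullet> z = (aconj y * aconj x) \<bullet> aconj z"
    by (metis aconj_mult inner_conj_conj)
  also have "\<dots> = aconj x \<bullet> (y * aconj z)" by (simp add: inner_mult_left aconj_conj)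
  finally show ?thesis by (simp add: inner_conj_left aconj_mult aconj_conj)
qed

lemma self_conj_real: "aconj x = x \<Longrightarrow> x = (x \<bullet> 1) *\<^sub>R (1 :: 'a::comp_alg)"
  using real_part[of x] by (metis mult_2 scaleR_2 scaleR_left.add scaleR_left_imp_eq
      scaleR_scaleR zero_neq_numeral)

text \<open>Polarization of \<open>conj_mult_cancel\<close>. With its mirror image it stands in for
  associativity when products must be rebracketed.\<close>

lemma conj_mult_cancel2:
  "aconj x * (z * y) + aconj z * (x * y) = (2 * (x \<bullet> z)) *\<^sub>R (y :: 'a::comp_alg)"
  using conj_mult_cancel[of "x + z" y] conj_mult_cancel[of x y] conj_mult_cancel[of z y]
  by (simp add: alg_simps inner_add_left inner_add_right inner_commute scaleR_add_left)
    (simp add: algebra_simps mult_2 scaleR_2 flip: scaleR_scaleR)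

lemma mult_conj_cancel2:
  "(y * x) * aconj z + (y * z) * aconj x = (2 * (x \<bullet> z)) *\<^sub>R (y :: 'a::comp_alg)"
  using mult_conj_cancel[of y "x + z"] mult_conj_cancel[of y x] mult_conj_cancel[of y z]
  by (simp add: alg_simps inner_add_left inner_add_right inner_commute scaleR_add_left)
    (simp add: algebra_simps mult_2 scaleR_2 flip: scaleR_scaleR)

lemma alg_no_zero_divisors: "x * y = 0 \<Longrightarrow> x = 0 \<or> y = (0 :: 'a::comp_alg)"
  using conj_mult_cancel[of x y] by simp

section \<open>Cayley-Dickson doubles as composition algebras\<close>

lemma inner_CD: "CD (a, b) \<bullet> CD (c, d) = a \<bullet> c + b \<bullet> d"
  by (simp add: inner_cd.abs_eq inner_Pair)

instantiation cd :: (euclidean_space) euclidean_space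
begin

definition Basis_cd :: "'a cd set" where
  "Basis_cd = (\<lambda>b. CD (b, 0)) ` Basis \<union> (\<lambda>b. CD (0, b)) ` Basis"

instance
proof
  show "(Basis :: 'a cd set) \<noteq> {}" "finite (Basis :: 'a cd set)"
    by (simp_all add: Basis_cd_def)
next
  fix u v :: "'a cd" assume "u \<in> Basis" "v \<in> Basis"
  then show "u \<bullet> v = (if u = v then 1 else 0)"
    by (auto simp: Basis_cd_def inner_CD CD_inject inner_Basis)
next
  fix x :: "'a cd"
  obtain a b where x: "x = CD (a, b)" by (metis cd_pair_inverse surj_pair)
  show "(\<forall>u\<in>Basis. x \<bullet> u = 0) \<longleftrightarrow> x = 0"
    by (auto simp: x Basis_cd_def inner_CD euclidean_all_zero_iff zero_cd.abs_eq CD_inject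
        zero_prod_def ball_Un)
qed

end

lemma CD_simps:
  "CD (a, b) + CD (c, d) = CD (a + c, b + d)"
  "r *\<^sub>R CD (a, b) = CD (r *\<^sub>R a, r *\<^sub>R b)"
  by (simp_all add: plus_cd.abs_eq scaleR_cd.abs_eq)

lemma CD_alg_simps:
  fixes a b c d :: "'a::conj_algebra"
  shows "CD (a, b) * CD (c, d) = CD (a * c - aconj d * b, d * a + b * aconj c)"
  "1 = CD (1 :: 'a, 0)" "aconj (CD (a, b)) = CD (aconj a, - b)"
  by (simp_all add: times_cd.abs_eq one_cd.abs_eq aconj_cd.abs_eq)

lemma CD_cases: obtains a b where "x = CD (a, b)"
  by (metis cd_pair_inverse surj_pair)

text \<open>In the associative base a factor next to its own conjugate collapses to a scalar
  (\<open>sc\<close>); for the cancellation laws the remaining cross terms cancel.\<close>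

instance cd :: (assoc_comp_alg) comp_alg
proof
  fix x y z :: "'a cd"
  obtain a b where x: "x = CD (a, b)" by (rule CD_cases)
  obtain c d where y: "y = CD (c, d)" by (rule CD_cases)
  obtain e f where z: "z = CD (e, f)" by (rule CD_cases)
  have sc: "aconj u * (u * v) = (u \<bullet> u) *\<^sub>R v" "v * (u * aconj u) = (u \<bullet> u) *\<^sub>R v"
    "u * (aconj u * v) = (u \<bullet> u) *\<^sub>R v" "v * (aconj u * u) = (u \<bullet> u) *\<^sub>R v" for u v :: 'a
    using conj_mult_cancel[of "aconj u" v]
    by (simp_all add: conj_mult_cancel mult_conj_self conj_mult_self alg_simps inner_conj_self)
  show "x + aconj x = (2 * (x \<bullet> 1)) *\<^sub>R 1"
    by (simp add: x CD_alg_simps CD_simps inner_CD real_part CD_inject)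
  show "aconj x * (x * y) = (x \<bullet> x) *\<^sub>R y"
    by (simp add: x y CD_alg_simps CD_simps inner_CD CD_inject alg_simps alg_assoc sc scaleR_add_left)
  show "(y * x) * aconj x = (x \<bullet> x) *\<^sub>R y"
    by (simp add: x y CD_alg_simps CD_simps inner_CD CD_inject alg_simps alg_assoc sc scaleR_add_left)
  have "(aconj d * b) \<bullet> e = d \<bullet> (b * aconj e)"
    by (metis aconj_conj inner_commute inner_mult_left inner_mult_right)
  moreover have "(b * aconj c) \<bullet> f = c \<bullet> (aconj f * b)"
    by (metis aconj_conj inner_commute inner_mult_left inner_mult_right)
  ultimately show "(x * y) \<bullet> z = y \<bullet> (aconj x * z)"
    by (simp add: x y z CD_alg_simps inner_CD alg_simps inner_add_left inner_diff_left
        inner_add_right inner_diff_right inner_mult_left[of a c] inner_mult_right[of d a])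
qed

instance cd :: (comm_comp_alg) assoc_comp_alg
proof
  fix x y z :: "'a cd"
  obtain a b where x: "x = CD (a, b)" by (rule CD_cases)
  obtain c d where y: "y = CD (c, d)" by (rule CD_cases)
  obtain e f where z: "z = CD (e, f)" by (rule CD_cases)
  have lc: "u * (v * w) = v * (u * w)" for u v w :: 'a
    by (metis alg_assoc alg_comm)
  show "x * y * z = x * (y * z)"
    by (simp add: x y z CD_alg_simps CD_simps CD_inject alg_simps alg_assoc alg_comm lc)
qed

section \<open>Coordinates on Hermitian matrices\<close>

text \<open>The off-diagonal entries are listed as \<open>(2,3)\<close>, \<open>(3,1)\<close>, \<open>(1,2)\<close>; with this order
  the product formula is invariant under cyclic permutations.\<close>

lift_definition hm :: "real \<Rightarrow> real \<Rightarrow> real \<Rightarrow> 'a \<Rightarrow> 'a \<Rightarrow> 'a \<Rightarrow> ('a::conj_algebra) herm" is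
  "\<lambda>d e f x y z. vector [vector [d *\<^sub>R 1, z, aconj y], vector [aconj z, e *\<^sub>R 1, x],
     vector [y, aconj x, f *\<^sub>R 1]]"
proof -
  fix d e f :: real and x y z :: 'a and i j :: 3
  let ?M = "vector [vector [d *\<^sub>R 1, z, aconj y], vector [aconj z, e *\<^sub>R 1, x],
     vector [y, aconj x, f *\<^sub>R 1]] :: 'a ^ 3 ^ 3"
  have "\<forall>i j. aconj (?M $ i $ j) = ?M $ j $ i"
    by (simp add: forall_3 aconj_scaleR aconj_one aconj_conj)
  then show "aconj (?M $ i $ j) = ?M $ j $ i" by blast
qed

lemma vec3_ext: "v = w \<longleftrightarrow> v $ 1 = w $ 1 \<and> v $ 2 = w $ 2 \<and> v $ 3 = w $ (3 :: 3)"
  by (simp add: vec_eq_iff forall_3)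

lemma herm_eqI:
  assumes "mat_of X $ 1 $ 1 = mat_of Y $ 1 $ 1" "mat_of X $ 2 $ 2 = mat_of Y $ 2 $ 2"
    "mat_of X $ 3 $ 3 = mat_of Y $ 3 $ 3" "mat_of X $ 2 $ 3 = mat_of Y $ 2 $ 3"
    "mat_of X $ 3 $ 1 = mat_of Y $ 3 $ 1" "mat_of X $ 1 $ 2 = mat_of Y $ 1 $ 2"
  shows "X = Y"
proof -
  have "aconj (mat_of Z $ i $ j) = mat_of Z $ j $ i" for Z :: "'a herm" and i j
    using mat_of[of Z] by simp
  then have "mat_of X $ 3 $ 2 = mat_of Y $ 3 $ 2" "mat_of X $ 1 $ 3 = mat_of Y $ 1 $ 3"
    "mat_of X $ 2 $ 1 = mat_of Y $ 2 $ 1"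
    using assms(4-6) by metis+
  then show ?thesis
    using assms by (simp add: mat_of_inject[symmetric] vec3_ext)
qed

lemma hm_cases:
  fixes X :: "'a::comp_alg herm"
  obtains d e f x y z where "X = hm d e f x y z"
proof -
  let ?M = "mat_of X"
  have M: "aconj (?M $ i $ j) = ?M $ j $ i" for i j
    using mat_of[of X] by simp
  have "X = hm (?M $ 1 $ 1 \<bullet> 1) (?M $ 2 $ 2 \<bullet> 1) (?M $ 3 $ 3 \<bullet> 1) (?M $ 2 $ 3) (?M $ 3 $ 1) (?M $ 1 $ 2)"
    using self_conj_real[OF M, of 1] self_conj_real[OF M, of 2] self_conj_real[OF M, of 3]
    by (intro herm_eqI) (simp_all only: hm.rep_eq vector_3)
  then show ?thesis using that by blast
qed

lemma hm_inject [simp]: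
  fixes x :: "'a::comp_alg"
  shows "hm d e f x y z = hm d' e' f' x' y' z' \<longleftrightarrow>
    d = d' \<and> e = e' \<and> f = f' \<and> x = x' \<and> y = y' \<and> z = z'"
  using one_nonzero[where 'a='a] by transfer (auto simp: vec3_ext)

lemma hm_arith:
  "hm d e f x y z + hm d' e' f' x' y' z' = hm (d + d') (e + e') (f + f') (x + x') (y + y') (z + z')"
  "hm d e f x y z - hm d' e' f' x' y' z' = hm (d - d') (e - e') (f - f') (x - x') (y - y') (z - z')"
  "- hm d e f x y z = hm (- d) (- e) (- f) (- x) (- y) (- z)"
  "r *\<^sub>R hm d e f x y z = hm (r * d) (r * e) (r * f) (r *\<^sub>R x) (r *\<^sub>R y) (r *\<^sub>R z)"
  "0 = hm 0 0 0 0 0 0"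
  by (transfer; simp add: vec3_ext aconj_add aconj_scaleR aconj_diff aconj_uminus
      scaleR_add_left scaleR_diff_left)+

lemma Diag_hm: "Diag a b c = hm a b c 0 0 0"
  by transfer (simp add: vec3_ext)

lemma inner_hm:
  fixes x :: "'a::comp_alg"
  shows "hm d e f x y z \<bullet> hm d' e' f' x' y' z' =
    d * d' + e * e' + f * f' + 2 * (x \<bullet> x' + y \<bullet> y' + z \<bullet> z')"
  by transfer (simp add: inner_vec_def sum_3 inner_conj_conj)

lemma tr_hm: "tr (hm d e f x y z) = (d + e + f) *\<^sub>R 1"
  by (simp add: tr_def hm.rep_eq sum_3 scaleR_add_left)

lemma jordan_hm:
  fixes x :: "'a::comp_alg"
  shows "hm d e f x y z \<circ>\<^sub>J hm d' e' f' x' y' z' = hm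
    (d * d' + y \<bullet> y' + z \<bullet> z') (e * e' + z \<bullet> z' + x \<bullet> x') (f * f' + x \<bullet> x' + y \<bullet> y')
    ((1/2) *\<^sub>R ((e + f) *\<^sub>R x' + (e' + f') *\<^sub>R x + aconj (y' * z) + aconj (y * z')))
    ((1/2) *\<^sub>R ((f + d) *\<^sub>R y' + (f' + d') *\<^sub>R y + aconj (z' * x) + aconj (z * x')))
    ((1/2) *\<^sub>R ((d + e) *\<^sub>R z' + (d' + e') *\<^sub>R z + aconj (x' * y) + aconj (x * y')))"
    (is "_ = ?R")
proof -
  have 1: "u * aconj v + v * aconj u = (2 * (u \<bullet> v)) *\<^sub>R 1" for u v :: 'a
    using mult_conj_cancel2[of 1 u v] by (simp add: alg_one_left)
  have 2: "aconj u * v + aconj v * u = (2 * (u \<bullet> v)) *\<^sub>R 1" for u v :: 'a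
    using conj_mult_cancel2[of u v 1] by (simp add: alg_one_right)
  let ?X = "hm d e f x y z" and ?Y = "hm d' e' f' x' y' z'"
  have J: "mat_of (?X \<circ>\<^sub>J ?Y) $ i $ j = (1/2) *\<^sub>R (mat_prod (mat_of ?X) (mat_of ?Y) $ i $ j
      + mat_prod (mat_of ?Y) (mat_of ?X) $ i $ j)" for i j
    by (simp add: jordan.rep_eq)
  have half: "(1/2) *\<^sub>R (A + (B + C) + (A + (B' + C'))) = A + b *\<^sub>R 1 + c *\<^sub>R 1"
    if "B + B' = (2 * b) *\<^sub>R 1" "C + C' = (2 * c) *\<^sub>R 1" for A B C B' C' :: 'a and b c
  proof -
    have "A + (B + C) + (A + (B' + C')) = 2 *\<^sub>R A + (B + B') + (C + C')"
      by (simp add: scaleR_2)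
    then show ?thesis by (simp only: that) (simp add: scaleR_add_right)
  qed
  note s = J mat_prod_def sum_3 hm.rep_eq alg_simps
  show ?thesis
  proof (rule herm_eqI)
    show "mat_of (?X \<circ>\<^sub>J ?Y) $ 1 $ 1 = mat_of ?R $ 1 $ 1"
      using half[OF 2[of y y'] 1[of z z'], of "(d * d') *\<^sub>R 1"]
      by (simp add: s scaleR_add_left ac_simps del: scaleR_half_double)
  next
    show "mat_of (?X \<circ>\<^sub>J ?Y) $ 2 $ 2 = mat_of ?R $ 2 $ 2"
      using half[OF 2[of z z'] 1[of x x'], of "(e * e') *\<^sub>R 1"]
      by (simp add: s scaleR_add_left ac_simps)
  next
    show "mat_of (?X \<circ>\<^sub>J ?Y) $ 3 $ 3 = mat_of ?R $ 3 $ 3"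
      using half[OF 2[of x x'] 1[of y y'], of "(f * f') *\<^sub>R 1"]
      by (simp add: s scaleR_add_left ac_simps)
  qed (simp_all add: s scaleR_add_left ac_simps)
qed

text \<open>Cyclicity of the real part of (y z) x, which survives without associativity.\<close>

lemma inner_conj_mult_cyclic: "aconj (y * z) \<bullet> x = aconj (z * x) \<bullet> (y :: 'a::comp_alg)"
proof -
  have "aconj (y * z) \<bullet> x = (y * z) \<bullet> aconj x" by (rule inner_conj_left)
  also have "\<dots> = y \<bullet> (aconj x * aconj z)" by (rule inner_mult_right)
  finally show ?thesis by (simp add: aconj_mult inner_commute)
qed

lemma jordan_commute: "X \<circ>\<^sub>J Y = Y \<circ>\<^sub>J X"
  by transfer (simp add: add.commute)

lemma bilinear_jordan: "bilinear ((\<circ>\<^sub>J) :: 'a::conj_algebra herm \<Rightarrow> _)"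
proof -
  have p: "mat_prod X (Y + Z) = mat_prod X Y + mat_prod X Z" "mat_prod (Y + Z) X = mat_prod Y X + mat_prod Z X"
    "mat_prod X (r *\<^sub>R Y) = r *\<^sub>R mat_prod X Y" "mat_prod (r *\<^sub>R Y) X = r *\<^sub>R mat_prod Y X"
    for X Y Z :: "'a ^ 3 ^ 3" and r
    by (simp_all add: mat_prod_def vec_eq_iff alg_simps sum.distrib scaleR_sum_right)
  have "X \<circ>\<^sub>J (Y + Z) = X \<circ>\<^sub>J Y + X \<circ>\<^sub>J Z" "X \<circ>\<^sub>J (r *\<^sub>R Y) = r *\<^sub>R (X \<circ>\<^sub>J Y)" for X Y Z :: "'a herm" and r
    by (transfer; simp add: p scaleR_add_right add_ac)+
  moreover from this have "(Y + Z) \<circ>\<^sub>J X = Y \<circ>\<^sub>J X + Z \<circ>\<^sub>J X" "(r *\<^sub>R Y) \<circ>\<^sub>J X = r *\<^sub>R (Y \<circ>\<^sub>J X)" for X Y Z :: "'a herm" and r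
    by (metis jordan_commute)+
  ultimately show ?thesis by (auto simp: bilinear_def linear_iff)
qed

lemmas jordan_bilin =
  bilinear_ladd[OF bilinear_jordan] bilinear_radd[OF bilinear_jordan]
  bilinear_lmul[OF bilinear_jordan] bilinear_rmul[OF bilinear_jordan]
  bilinear_lneg[OF bilinear_jordan] bilinear_rneg[OF bilinear_jordan]
  bilinear_lzero[OF bilinear_jordan] bilinear_rzero[OF bilinear_jordan]
  bilinear_lsub[OF bilinear_jordan] bilinear_rsub[OF bilinear_jordan]

lemma jordan_unit: "unit_mat \<circ>\<^sub>J X = (X :: 'a::comp_alg herm)"
  by (cases X rule: hm_cases) (simp add: Diag_hm jordan_hm flip: scaleR_add_left)

text \<open>Terms with a diagonal entry match by symmetry, those with three off-diagonal entries by
  cyclicity of the real triple product; hence the twelve instances of \<open>c\<close>.\<close>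

lemma inner_jordan: "(X \<circ>\<^sub>J Y) \<bullet> Z = Y \<bullet> (X \<circ>\<^sub>J (Z :: 'a::comp_alg herm))"
proof -
  obtain d e f x y z where X: "X = hm d e f x y z" by (rule hm_cases)
  obtain d' e' f' x' y' z' where Y: "Y = hm d' e' f' x' y' z'" by (rule hm_cases)
  obtain d'' e'' f'' x'' y'' z'' where Z: "Z = hm d'' e'' f'' x'' y'' z''" by (rule hm_cases)
  note c = inner_conj_mult_cyclic
  show ?thesis
    using c[of y' z x''] c[of y z' x''] c[of z' x'' y] c[of z' x y''] c[of x y'' z'] c[of z x' y'']
      c[of x' y'' z] c[of x' y z''] c[of y z'' x'] c[of x y' z''] c[of y' z'' x] c[of z x'' y']
    by (simp add: X Y Z jordan_hm inner_hm inner_add_left inner_add_right inner_commute algebra_simps)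
qed

lemma tr_inner: "tr X = (X \<bullet> unit_mat) *\<^sub>R (1 :: 'a::comp_alg)"
  by (cases X rule: hm_cases) (simp add: Diag_hm tr_hm inner_hm)

lemma trace_slice_iff: "X \<in> trace_slice c \<longleftrightarrow> X \<bullet> unit_mat = (c :: real)"
  for X :: "'a::comp_alg herm"
  using one_nonzero[where 'a='a] by (simp add: trace_slice_def tr_inner)

lemma inner_square_unit: "(X \<circ>\<^sub>J X) \<bullet> unit_mat = X \<bullet> (X :: 'a::comp_alg herm)"
  by (metis inner_jordan jordan_commute jordan_unit)

instantiation herm :: (comp_alg) euclidean_space
begin

text \<open>Off-diagonal entries occur twice in the matrix, hence the factor
  \<open>sqrt (1/2)\<close>. The instance supplies finite dimension: linear maps are bounded,
  subspaces closed, closed bounded sets compact.\<close>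

definition Basis_herm :: "'a herm set" where
  "Basis_herm = {hm 1 0 0 0 0 0, hm 0 1 0 0 0 0, hm 0 0 1 0 0 0} \<union>
    (\<lambda>b. hm 0 0 0 (sqrt (1/2) *\<^sub>R b) 0 0) ` Basis \<union>
    (\<lambda>b. hm 0 0 0 0 (sqrt (1/2) *\<^sub>R b) 0) ` Basis \<union>
    (\<lambda>b. hm 0 0 0 0 0 (sqrt (1/2) *\<^sub>R b)) ` Basis"

instance
proof
  show "(Basis :: 'a herm set) \<noteq> {}" "finite (Basis :: 'a herm set)"
    by (simp_all add: Basis_herm_def)
next
  have "2 * (sqrt (1/2) * (sqrt (1/2) * r)) = r" for r
    by (simp flip: mult.assoc)
  moreover have "sqrt (1/2) \<noteq> 0" by simp
  moreover fix u v :: "'a herm" assume "u \<in> Basis" "v \<in> Basis"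
  ultimately show "u \<bullet> v = (if u = v then 1 else 0)"
    unfolding Basis_herm_def by (auto simp: inner_hm inner_Basis)
next
  fix X :: "'a herm"
  obtain d e f x y z where X: "X = hm d e f x y z" by (rule hm_cases)
  show "(\<forall>u\<in>Basis. X \<bullet> u = 0) \<longleftrightarrow> X = 0"
    by (auto simp: X Basis_herm_def inner_hm hm_arith(5) euclidean_all_zero_iff ball_Un)
qed

end

lemma bounded_bilinear_jordan: "bounded_bilinear ((\<circ>\<^sub>J) :: 'a::comp_alg herm \<Rightarrow> _)"
  using bilinear_jordan bilinear_conv_bounded_bilinear by blast

section \<open>Rotations\<close>

lemma square_hm:
  fixes x :: "'a::comp_alg"
  shows "hm d e f x y z \<circ>\<^sub>J hm d e f x y z = hm
    (d\<^sup>2 + y \<bullet> y + z \<bullet> z) (e\<^sup>2 + z \<bullet> z + x \<bullet> x) (f\<^sup>2 + x \<bullet> x + y \<bullet> y)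
    ((e + f) *\<^sub>R x + aconj (y * z)) ((f + d) *\<^sub>R y + aconj (z * x)) ((d + e) *\<^sub>R z + aconj (x * y))"
proof -
  have h: "(1/2) *\<^sub>R (r *\<^sub>R u + r *\<^sub>R u + v + v) = r *\<^sub>R u + v" for r and u v :: 'a
  proof -
    have "r *\<^sub>R u + r *\<^sub>R u + v + v = 2 *\<^sub>R (r *\<^sub>R u + v)"
      by (simp add: scaleR_2)
    then show ?thesis by simp
  qed
  show ?thesis by (simp only: jordan_hm power2_eq_square h)
qed

lemma jordan_derI:
  assumes D: "linear D" and sq: "\<And>X. D (X \<circ>\<^sub>J X) = 2 *\<^sub>R (X \<circ>\<^sub>J D X)"
  shows "D \<in> jordan_der"
proof -
  have "D (X \<circ>\<^sub>J Y) = D X \<circ>\<^sub>J Y + X \<circ>\<^sub>J D Y" for X Y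
  proof -
    have "2 *\<^sub>R D (X \<circ>\<^sub>J Y) = D ((X + Y) \<circ>\<^sub>J (X + Y)) - D (X \<circ>\<^sub>J X) - D (Y \<circ>\<^sub>J Y)"
      by (simp add: jordan_bilin linear_add[OF D] scaleR_2 jordan_commute[of Y X])
    also have "\<dots> = 2 *\<^sub>R (D X \<circ>\<^sub>J Y + X \<circ>\<^sub>J D Y)"
      by (simp only: sq) (simp add: jordan_bilin linear_add[OF D] scaleR_2 jordan_commute[of "D X" Y] algebra_simps)
    finally show ?thesis by simp
  qed
  then show ?thesis using D by (simp add: jordan_der_def)
qed

text \<open>For associative coefficients this is \<open>X \<mapsto> S X - X S\<close>, where \<open>S\<close> has the entries \<open>a\<close> and
  \<open>- aconj a\<close> at \<open>(1,2)\<close> and \<open>(2,1)\<close> and zeros elsewhere.\<close>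

definition rot_gen :: "'a \<Rightarrow> 'a::conj_algebra herm \<Rightarrow> 'a herm" where
  "rot_gen a X = 4 *\<^sub>R (hm 1 0 0 0 0 0 \<circ>\<^sub>J (hm 0 0 0 0 0 a \<circ>\<^sub>J X) - hm 0 0 0 0 0 a \<circ>\<^sub>J (hm 1 0 0 0 0 0 \<circ>\<^sub>J X))"

lemma rot_gen_hm:
  fixes a :: "'a::comp_alg"
  shows "rot_gen a (hm d e f x y z) =
    hm (2 * (a \<bullet> z)) (- 2 * (a \<bullet> z)) 0 (- aconj (y * a)) (aconj (a * x)) ((e - d) *\<^sub>R a)"
  by (simp add: rot_gen_def jordan_hm hm_arith alg_simps)
    (simp add: algebra_simps, simp flip: scaleR_add_left)

text \<open>By form an instance of \<open>inner_derivation\<close>; but that rests on the Jordan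
  identity, which is deduced from the spectral theorem and hence from these rotations. A direct
  check in coordinates avoids the circle.\<close>

lemma rot_gen_der: "rot_gen (a :: 'a::comp_alg) \<in> jordan_der"
proof (rule jordan_derI)
  show "linear (rot_gen a)"
    by (rule linearI) (simp_all add: rot_gen_def jordan_bilin algebra_simps)
  fix X :: "'a herm"
  obtain d e f x y z where X: "X = hm d e f x y z" by (rule hm_cases)
  \<comment> \<open>Rules 1 and 2 bring the differently bracketed products of both sides to a common
    form; rule 3 does so for the cubic inner products.\<close>
  have 1: "aconj y * (y * a) = (y \<bullet> y) *\<^sub>R a" "(a * x) * aconj x = (x \<bullet> x) *\<^sub>R a"
    by (simp_all add: conj_mult_cancel mult_conj_cancel)
  have 2: "aconj a * (z * x) = (2 * (a \<bullet> z)) *\<^sub>R x - aconj z * (a * x)"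
    "(y * z) * aconj a = (2 * (a \<bullet> z)) *\<^sub>R y - (y * a) * aconj z"
    using conj_mult_cancel2[of a z x] mult_conj_cancel2[of y z a] by (simp_all add: algebra_simps inner_commute)
  have 3: "y \<bullet> (aconj x * aconj a) = a \<bullet> (aconj y * aconj x)"
    "x \<bullet> (aconj a * aconj y) = a \<bullet> (aconj y * aconj x)"
    using inner_conj_mult_cyclic[of a x y] inner_conj_mult_cyclic[of y a x]
    by (simp_all add: inner_commute aconj_mult)
  show "rot_gen a (X \<circ>\<^sub>J X) = 2 *\<^sub>R (X \<circ>\<^sub>J rot_gen a X)"
    by (simp add: X square_hm rot_gen_hm jordan_hm hm_arith)
      (simp add: alg_simps 1 2 3 inner_commute[of z a] inner_add_right inner_diff_right power2_eq_square algebra_simps)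
qed

section \<open>Exponentials of operators\<close>

lemma funpow_norm_bound:
  fixes T :: "'v::real_normed_vector \<Rightarrow> 'v"
  assumes "bounded_linear T"
  obtains K where "K \<ge> 0" "\<And>k v. norm ((T ^^ k) v) \<le> K ^ k * norm v"
proof -
  obtain K where K: "K \<ge> 0" "\<And>v. norm (T v) \<le> K * norm v"
    using bounded_linear.nonneg_bounded[OF assms] by (metis mult.commute)
  have "norm ((T ^^ k) v) \<le> K ^ k * norm v" for k v
  proof (induction k)
    case (Suc k)
    have "norm ((T ^^ Suc k) v) \<le> K * norm ((T ^^ k) v)" using K(2) by simp
    also have "\<dots> \<le> K * (K ^ k * norm v)" by (rule mult_left_mono[OF Suc K(1)])
    finally show ?case by (simp add: mult_ac)
  qed simp
  then show ?thesis using K(1) that by blast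
qed

lemma summable_op_exp:
  fixes T :: "'v::banach \<Rightarrow> 'v"
  assumes "bounded_linear T"
  shows "summable (\<lambda>k. (t ^ k / fact k) *\<^sub>R (T ^^ k) v)"
proof -
  obtain K where K: "K \<ge> 0" "\<And>k v. norm ((T ^^ k) v) \<le> K ^ k * norm v"
    using funpow_norm_bound[OF assms] by blast
  have "summable (\<lambda>k. inverse (fact k) * (\<bar>t\<bar> * K) ^ k * norm v)"
    by (intro summable_mult2 summable_exp)
  moreover have "norm ((t ^ k / fact k) *\<^sub>R (T ^^ k) v) \<le> inverse (fact k) * (\<bar>t\<bar> * K) ^ k * norm v" for k
    using mult_left_mono[OF K(2)[of k v], of "\<bar>t\<bar> ^ k / fact k"]
    by (simp add: power_mult_distrib power_abs field_simps)
  ultimately show ?thesis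
    by (rule summable_comparison_test'[where N = 0])
qed

lemma funpow_scaleR:
  fixes T :: "'v::real_vector \<Rightarrow> 'v"
  assumes "linear T"
  shows "((\<lambda>w. t *\<^sub>R T w) ^^ k) v = t ^ k *\<^sub>R (T ^^ k) v"
  by (induction k) (simp_all add: linear_scale[OF assms])

lemma op_exp_scaled:
  fixes T :: "'v::real_normed_vector \<Rightarrow> 'v"
  assumes "linear T"
  shows "op_exp (\<lambda>w. t *\<^sub>R T w) v = (\<Sum>k. (t ^ k / fact k) *\<^sub>R (T ^^ k) v)"
  by (simp add: op_exp_def funpow_scaleR[OF assms])

text \<open>Paired with a basis vector, the exponential is a scalar power series in t that converges
  everywhere, so it may be differentiated termwise.\<close>

lemma op_exp_has_vector_derivative:
  fixes T :: "'v::euclidean_space \<Rightarrow> 'v"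
  assumes T: "linear T"
  shows "((\<lambda>t. op_exp (\<lambda>w. t *\<^sub>R T w) v) has_vector_derivative T (op_exp (\<lambda>w. t *\<^sub>R T w) v)) (at t)"
proof -
  have bT: "bounded_linear T" using T by (simp add: linear_conv_bounded_linear)
  have comp: "op_exp (\<lambda>w. s *\<^sub>R T w) u \<bullet> b = (\<Sum>k. ((T ^^ k) u \<bullet> b / fact k) * s ^ k)"
    and summ: "summable (\<lambda>k. ((T ^^ k) u \<bullet> b / fact k) * s ^ k)" for s u b
    using bounded_linear.suminf[OF bounded_linear_inner_left summable_op_exp[OF bT, of s u], of b]
      bounded_linear.summable[OF bounded_linear_inner_left summable_op_exp[OF bT, of s u], of b]
    by (simp_all add: op_exp_scaled[OF T] mult.commute)
  have comm: "T (op_exp (\<lambda>w. t *\<^sub>R T w) v) = op_exp (\<lambda>w. t *\<^sub>R T w) (T v)"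
    using bounded_linear.suminf[OF bT summable_op_exp[OF bT, of t v]]
    by (simp add: op_exp_scaled[OF T] linear_scale[OF T] funpow_swap1)
  show ?thesis
    unfolding has_vector_derivative_def comm
  proof (subst has_derivative_componentwise_within, intro ballI)
    fix b :: 'v assume "b \<in> Basis"
    let ?c = "\<lambda>k. (T ^^ k) v \<bullet> b / fact k"
    have "diffs ?c k = (T ^^ k) (T v) \<bullet> b / fact k" for k
      by (simp add: diffs_def funpow_swap1 del: of_nat_Suc)
    then have "((\<lambda>s. \<Sum>k. ?c k * s ^ k) has_field_derivative op_exp (\<lambda>w. t *\<^sub>R T w) (T v) \<bullet> b) (at t)"
      using termdiffs_strong_converges_everywhere[of ?c t] summ comp by simp
    then show "((\<lambda>s. op_exp (\<lambda>w. s *\<^sub>R T w) v \<bullet> b) has_derivative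
        (\<lambda>h. (h *\<^sub>R op_exp (\<lambda>w. t *\<^sub>R T w) (T v)) \<bullet> b)) (at t)"
      by (simp add: comp has_field_derivative_def mult_commute_abs)
  qed
qed

lemma op_exp_zero: "op_exp (\<lambda>w. 0) v = v"
proof -
  have "(\<lambda>k. (1 / fact k) *\<^sub>R ((\<lambda>w. 0) ^^ k) v) = (\<lambda>k. if k = 0 then v else 0)"
  proof
    show "(1 / fact k) *\<^sub>R ((\<lambda>w. 0) ^^ k) v = (if k = 0 then v else 0)" for k
      by (cases k) simp_all
  qed
  then show ?thesis using sums_single[of 0 "\<lambda>_. v"] by (simp add: op_exp_def sums_iff)
qed

text \<open>A solution of a linear differential equation that vanishes at \<open>0\<close> vanishes at \<open>1\<close>, since
  \<open>exp (- 2 K t) * (norm (\<gamma> t))\<^sup>2\<close> is non-increasing for \<open>K\<close> a bound of the operator.\<close>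

lemma linear_ode_zero:
  fixes T :: "'v::euclidean_space \<Rightarrow> 'v"
  assumes T: "linear T" and der: "\<And>t. (\<gamma> has_vector_derivative T (\<gamma> t)) (at t)" and "\<gamma> 0 = 0"
  shows "\<gamma> 1 = 0"
proof -
  obtain K where K: "\<And>v. norm (T v) \<le> norm v * K"
    using bounded_linear.bounded T by (auto simp: linear_conv_bounded_linear)
  let ?f = "\<lambda>t. exp (- 2 * K * t) * (\<gamma> t \<bullet> \<gamma> t)"
  let ?f' = "\<lambda>t. exp (- 2 * K * t) * (2 * (\<gamma> t \<bullet> T (\<gamma> t)) - 2 * K * (\<gamma> t \<bullet> \<gamma> t))"
  have "(?f has_real_derivative ?f' t) (at t)" for t
  proof -
    have "((\<lambda>t. \<gamma> t \<bullet> \<gamma> t) has_real_derivative 2 * (\<gamma> t \<bullet> T (\<gamma> t))) (at t)"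
      using bounded_bilinear.has_vector_derivative[OF bounded_bilinear_inner der der]
      by (simp add: has_real_derivative_iff_has_vector_derivative inner_commute)
    then show ?thesis
      by (auto intro!: derivative_eq_intros simp: algebra_simps)
  qed
  moreover have "?f' t \<le> 0" for t
  proof -
    have "\<gamma> t \<bullet> T (\<gamma> t) \<le> norm (\<gamma> t) * (norm (\<gamma> t) * K)"
      using norm_cauchy_schwarz[of "\<gamma> t" "T (\<gamma> t)"] mult_left_mono[OF K, of "norm (\<gamma> t)" "\<gamma> t"] by simp
    then show ?thesis
      by (simp add: mult_nonneg_nonpos algebra_simps dot_square_norm power2_eq_square)
  qed
  ultimately have "?f 1 \<le> ?f 0"
    by (intro DERIV_nonpos_imp_nonincreasing[of 0 1 ?f]) (simp, blast)
  then have "\<gamma> 1 \<bullet> \<gamma> 1 \<le> 0" using \<open>\<gamma> 0 = 0\<close> by (simp add: mult_le_0_iff)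
  then show ?thesis by (metis inner_ge_zero inner_eq_zero_iff order_antisym)
qed

text \<open>Uniqueness of solutions: an exponential is computed by exhibiting a solution curve,
  without touching the series.\<close>

lemma op_exp_curve:
  fixes T :: "'v::euclidean_space \<Rightarrow> 'v"
  assumes T: "linear T" and der: "\<And>t. (\<gamma> has_vector_derivative T (\<gamma> t)) (at t)"
  shows "op_exp T (\<gamma> 0) = \<gamma> 1"
proof -
  let ?E = "\<lambda>t. op_exp (\<lambda>w. t *\<^sub>R T w) (\<gamma> 0)"
  have "?E 1 - \<gamma> 1 = 0"
  proof (rule linear_ode_zero[OF T, where \<gamma> = "\<lambda>t. ?E t - \<gamma> t"])
    show "((\<lambda>t. ?E t - \<gamma> t) has_vector_derivative T (?E t - \<gamma> t)) (at t)" for t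
      using has_vector_derivative_diff[OF op_exp_has_vector_derivative[OF T] der]
      by (simp add: linear_diff[OF T])
  qed (simp add: op_exp_zero)
  then show ?thesis by simp
qed

lemma op_exp_intertwine:
  fixes P :: "'v::euclidean_space \<Rightarrow> 'w::euclidean_space"
  assumes P: "linear P" and T: "linear T" and S: "linear S" and "\<And>v. P (T v) = S (P v)"
  shows "P (op_exp T v) = op_exp S (P v)"
proof -
  have bP: "bounded_linear P" using P by (simp add: linear_conv_bounded_linear)
  have "op_exp S (P (op_exp (\<lambda>w. 0 *\<^sub>R T w) v)) = P (op_exp (\<lambda>w. 1 *\<^sub>R T w) v)"
    using op_exp_curve[OF S, of "\<lambda>t. P (op_exp (\<lambda>w. t *\<^sub>R T w) v)"]
      bounded_linear.has_vector_derivative[OF bP op_exp_has_vector_derivative[OF T]] assms(4) by simp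
  then show ?thesis by (simp add: op_exp_zero)
qed

lemma linear_op_exp:
  fixes T :: "'v::euclidean_space \<Rightarrow> 'v"
  assumes T: "linear T"
  shows "linear (op_exp T)"
proof (rule linearI)
  fix u v :: 'v and r :: real
  let ?E = "\<lambda>t v. op_exp (\<lambda>w. t *\<^sub>R T w) v"
  note d = op_exp_has_vector_derivative[OF T]
  show "op_exp T (u + v) = op_exp T u + op_exp T v"
    using op_exp_curve[OF T, of "\<lambda>t. ?E t u + ?E t v"] has_vector_derivative_add[OF d d]
    by (simp add: linear_add[OF T] op_exp_zero)
  show "op_exp T (r *\<^sub>R v) = r *\<^sub>R op_exp T v"
    by (rule op_exp_intertwine[symmetric])
      (simp_all add: T linear_scale[OF T] linear_scale_self module_hom_scale_self)
qed

text \<open>Reversed in time, the flow line of \<open>T\<close> from \<open>v\<close> solves the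
  equation of \<open>- T\<close> and ends at \<open>v\<close>.\<close>

lemma op_exp_minus:
  fixes T :: "'v::euclidean_space \<Rightarrow> 'v"
  assumes T: "linear T"
  shows "op_exp (\<lambda>w. - T w) (op_exp T v) = v"
proof -
  let ?E = "\<lambda>t. op_exp (\<lambda>w. t *\<^sub>R T w) v"
  have "((\<lambda>t. ?E (1 - t)) has_vector_derivative - T (?E (1 - t))) (at t)" for t
    using vector_diff_chain_at[of "\<lambda>t. 1 - t" "-1" t ?E] op_exp_has_vector_derivative[OF T, of v "1 - t"]
    by (force simp: o_def intro!: derivative_eq_intros)
  then show ?thesis
    using op_exp_curve[of "\<lambda>w. - T w" "\<lambda>t. ?E (1 - t)"] T
    by (simp add: linear_compose_neg op_exp_zero)
qed

lemma bij_op_exp: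
  fixes T :: "'v::euclidean_space \<Rightarrow> 'v"
  assumes T: "linear T"
  shows "bij (op_exp T)"
proof (rule o_bij)
  show "op_exp (\<lambda>w. - T w) \<circ> op_exp T = id"
    using op_exp_minus[OF T] by (simp add: fun_eq_iff)
  show "op_exp T \<circ> op_exp (\<lambda>w. - T w) = id"
    using op_exp_minus[OF linear_compose_neg[OF T]] by (simp add: fun_eq_iff)
qed

text \<open>By the Leibniz rule \<open>der\<close>, the product of the two flow lines solves the
  equation of \<open>T3\<close>. Taking \<open>T3\<close> zero later turns skewness into
  isometry.\<close>

lemma op_exp_bilinear:
  fixes \<beta> :: "'u::euclidean_space \<Rightarrow> 'v::euclidean_space \<Rightarrow> 'w::euclidean_space"
  assumes "bilinear \<beta>" and T: "linear T1" "linear T2" "linear T3"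
    and der: "\<And>u v. T3 (\<beta> u v) = \<beta> (T1 u) v + \<beta> u (T2 v)"
  shows "op_exp T3 (\<beta> u v) = \<beta> (op_exp T1 u) (op_exp T2 v)"
proof -
  let ?\<gamma> = "\<lambda>t. \<beta> (op_exp (\<lambda>w. t *\<^sub>R T1 w) u) (op_exp (\<lambda>w. t *\<^sub>R T2 w) v)"
  have "bounded_bilinear \<beta>" using assms(1) bilinear_conv_bounded_bilinear by blast
  then have "(?\<gamma> has_vector_derivative T3 (?\<gamma> t)) (at t)" for t
    using bounded_bilinear.has_vector_derivative[OF _ op_exp_has_vector_derivative[OF T(1)]
        op_exp_has_vector_derivative[OF T(2)]]
    by (simp add: der add.commute)
  then show ?thesis
    using op_exp_curve[OF T(3), of ?\<gamma>] by (simp add: op_exp_zero)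
qed

section \<open>Derivations and automorphisms\<close>

definition cyc_index :: "3 \<Rightarrow> 3" where
  "cyc_index i = (if i = 1 then 2 else if i = 2 then 3 else 1)"

text \<open>Conjugation by a cyclic permutation matrix; it carries facts about one diagonal
  idempotent or one off-diagonal slot to the other two.\<close>

lift_definition cyc :: "'a::conj_algebra herm \<Rightarrow> 'a herm" is
  "\<lambda>X. \<chi> i j. X $ cyc_index i $ cyc_index j"
  by simp

lemma cyc_hm: "cyc (hm d e f x y z) = hm e f d y z x"
  by (rule herm_eqI) (simp_all add: cyc.rep_eq hm.rep_eq cyc_index_def)

lemma linear_cyc: "linear cyc"
  by (rule linearI; transfer; simp add: vec_eq_iff)

lemma cyc_cyc_cyc: "cyc (cyc (cyc X)) = (X :: 'a::comp_alg herm)"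
  by (cases X rule: hm_cases) (simp add: cyc_hm)

lemma cyc_jordan: "cyc (X \<circ>\<^sub>J Y) = cyc X \<circ>\<^sub>J cyc (Y :: 'a::comp_alg herm)"
  by (cases X rule: hm_cases, cases Y rule: hm_cases) (simp add: cyc_hm jordan_hm)

lemma jordan_der_linear: "D \<in> jordan_der \<Longrightarrow> linear D"
  by (simp add: jordan_der_def)

lemma jordan_der_mult: "D \<in> jordan_der \<Longrightarrow> D (X \<circ>\<^sub>J Y) = D X \<circ>\<^sub>J Y + X \<circ>\<^sub>J D Y"
  by (simp add: jordan_der_def)

lemma jordan_der_scale: "D \<in> jordan_der \<Longrightarrow> (\<lambda>X. r *\<^sub>R D X) \<in> jordan_der"
  by (auto simp: jordan_der_def jordan_bilin linear_compose_scale_right scaleR_add_right)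

lemma jordan_der_cyc:
  fixes D :: "'a::comp_alg herm \<Rightarrow> 'a herm"
  assumes "D \<in> jordan_der"
  shows "(\<lambda>X. cyc (D (cyc (cyc X)))) \<in> jordan_der"
proof -
  have "linear (cyc \<circ> (D \<circ> (cyc \<circ> cyc)))"
    by (intro linear_compose linear_cyc jordan_der_linear assms)
  then show ?thesis
    by (simp add: jordan_der_def o_def cyc_jordan jordan_der_mult[OF assms] linear_add[OF linear_cyc] cyc_cyc_cyc)
qed

lemma jordan_der_unit:
  fixes D :: "'a::comp_alg herm \<Rightarrow> 'a herm"
  assumes "D \<in> jordan_der"
  shows "D unit_mat = 0"
  using jordan_der_mult[OF assms, of unit_mat unit_mat]
  by (simp add: jordan_unit jordan_commute[of "D unit_mat"])

lemma hm_split: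
  fixes x :: "'a::comp_alg"
  shows "hm d e f x y z = d *\<^sub>R hm 1 0 0 0 0 0 + e *\<^sub>R hm 0 1 0 0 0 0 + f *\<^sub>R hm 0 0 1 0 0 0
    + hm 0 0 0 x 0 0 + hm 0 0 0 0 y 0 + hm 0 0 0 0 0 z"
  by (simp add: hm_arith)

text \<open>Differentiating the idempotent equation puts the derivative into the Peirce 1/2-space of
  the idempotent.\<close>

lemma jordan_der_idem:
  fixes D :: "'a::comp_alg herm \<Rightarrow> 'a herm"
  assumes D: "D \<in> jordan_der"
  obtains y z where "D (hm 1 0 0 0 0 0) = hm 0 0 0 0 y z"
proof -
  let ?e = "hm 1 0 0 0 0 0 :: 'a herm"
  obtain d e f x y z where h: "D ?e = hm d e f x y z" by (rule hm_cases)
  have "?e \<circ>\<^sub>J ?e = ?e" by (simp add: jordan_hm)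
  then have "D ?e = 2 *\<^sub>R (?e \<circ>\<^sub>J D ?e)"
    using jordan_der_mult[OF D, of ?e ?e] by (simp add: scaleR_2 jordan_commute[of "D ?e"])
  then show ?thesis using that by (simp add: h jordan_hm hm_arith)
qed

lemma jordan_der_offdiag_trace:
  fixes D :: "'a::comp_alg herm \<Rightarrow> 'a herm"
  assumes D: "D \<in> jordan_der"
  shows "D (hm 0 0 0 x 0 0) \<bullet> unit_mat = 0"
proof (cases "x = 0")
  case True
  then show ?thesis
    using linear_0[OF jordan_der_linear[OF D]] by (simp flip: hm_arith(5))
next
  case False
  let ?e = "hm 1 0 0 0 0 0 :: 'a herm" and ?F = "hm 0 0 0 x 0 0"
  obtain y z where e: "D ?e = hm 0 0 0 0 y z" using jordan_der_idem[OF D] .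
  obtain d' e' f' x' y' z' where F: "D ?F = hm d' e' f' x' y' z'" by (rule hm_cases)
  \<comment> \<open>Differentiating these relations determines the trace of \<open>D ?F\<close>: the
    second gives its (1,1) entry, the (2,3) entry of the first the sum of the other two.\<close>
  have "?F \<circ>\<^sub>J ?F = (x \<bullet> x) *\<^sub>R (unit_mat - ?e)" "?e \<circ>\<^sub>J ?F = 0"
    by (simp_all add: jordan_hm Diag_hm hm_arith)
  then have "D (?F \<circ>\<^sub>J ?F) = (x \<bullet> x) *\<^sub>R (- D ?e)" "D (?e \<circ>\<^sub>J ?F) = 0"
    using jordan_der_linear[OF D] jordan_der_unit[OF D]
    by (simp_all add: linear_scale linear_diff linear_0)
  then have "2 *\<^sub>R (?F \<circ>\<^sub>J D ?F) = (x \<bullet> x) *\<^sub>R (- D ?e)" "D ?e \<circ>\<^sub>J ?F + ?e \<circ>\<^sub>J D ?F = 0"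
    by (simp_all add: jordan_der_mult[OF D] scaleR_2 jordan_commute[of "D ?F"])
  then have "d' = 0" "(e' + f') *\<^sub>R x = 0"
    by (auto simp: e F jordan_hm hm_arith)
  then show ?thesis using False by (simp add: F Diag_hm inner_hm)
qed

lemma inner_cyc_unit: "cyc X \<bullet> unit_mat = X \<bullet> (unit_mat :: 'a::comp_alg herm)"
  by (cases X rule: hm_cases) (simp add: cyc_hm Diag_hm inner_hm)

text \<open>By linearity the six coordinate slots suffice; one idempotent and one off-diagonal slot
  are known, and \<open>cyc\<close> supplies the others. The purpose is skewness of
  derivations.\<close>

lemma jordan_der_trace:
  fixes D :: "'a::comp_alg herm \<Rightarrow> 'a herm"
  assumes D: "D \<in> jordan_der"
  shows "D X \<bullet> unit_mat = 0"
proof -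
  have "D' (hm 1 0 0 0 0 0) \<bullet> unit_mat = 0" if D': "D' \<in> jordan_der" for D' :: "'a herm \<Rightarrow> 'a herm"
    using jordan_der_idem[OF D'] by (metis (no_types, lifting) Diag_hm add.right_neutral inner_hm
        inner_zero_right mult_zero_left mult_zero_right)
  note t = this jordan_der_offdiag_trace
  note c1 = jordan_der_cyc[OF D] and c2 = jordan_der_cyc[OF jordan_der_cyc[OF D]]
  obtain d e f x y z where X: "X = hm d e f x y z" by (rule hm_cases)
  have "D (hm 1 0 0 0 0 0) \<bullet> unit_mat = 0" "D (hm 0 1 0 0 0 0) \<bullet> unit_mat = 0"
    "D (hm 0 0 1 0 0 0) \<bullet> unit_mat = 0" "D (hm 0 0 0 x 0 0) \<bullet> unit_mat = 0"
    "D (hm 0 0 0 0 y 0) \<bullet> unit_mat = 0" "D (hm 0 0 0 0 0 z) \<bullet> unit_mat = 0"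
    using t(1)[OF D] t(1)[OF c1] t(1)[OF c2] t(2)[OF D, of x] t(2)[OF c1, of z] t(2)[OF c1, of y]
      t(2)[OF c2, of z] t(2)[OF c2, of y]
    by (simp_all add: cyc_hm inner_cyc_unit)
  then show ?thesis
    unfolding X hm_split[of d]
    by (simp add: linear_add[OF jordan_der_linear[OF D]] linear_scale[OF jordan_der_linear[OF D]] inner_add_left)
qed

lemma inner_jordan_unit: "(X \<circ>\<^sub>J Y) \<bullet> unit_mat = X \<bullet> (Y :: 'a::comp_alg herm)"
  by (metis inner_commute inner_jordan jordan_commute jordan_unit)

lemma jordan_der_skew:
  fixes D :: "'a::comp_alg herm \<Rightarrow> 'a herm"
  assumes D: "D \<in> jordan_der"
  shows "D X \<bullet> Y = - (X \<bullet> D Y)"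
  using jordan_der_trace[OF D, of "X \<circ>\<^sub>J Y"]
  by (simp add: jordan_der_mult[OF D] inner_add_left inner_jordan_unit)

text \<open>Diagonalization is carried out in this part of \<open>jordan_aut\<close>: its elements
  are isometries, as is checked on generators, and they extend to elements of
  \<open>G_hat\<close>.\<close>

inductive_set der_group :: "('a::comp_alg herm \<Rightarrow> 'a herm) set" where
  der_group_id: "id \<in> der_group"
| der_group_exp: "D \<in> jordan_der \<Longrightarrow> h \<in> der_group \<Longrightarrow> op_exp D \<circ> h \<in> der_group"

lemma op_exp_der_group: "D \<in> jordan_der \<Longrightarrow> op_exp D \<in> der_group"
  using der_group_exp[OF _ der_group_id] by simp

lemma der_group_comp: "g \<in> der_group \<Longrightarrow> h \<in> der_group \<Longrightarrow> g \<circ> h \<in> der_group"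
  by (induction g rule: der_group.induct) (simp_all add: der_group_exp flip: o_assoc)

lemma op_exp_jordan:
  fixes D :: "'a::comp_alg herm \<Rightarrow> 'a herm"
  assumes "D \<in> jordan_der"
  shows "op_exp D (X \<circ>\<^sub>J Y) = op_exp D X \<circ>\<^sub>J op_exp D Y"
  using assms by (intro op_exp_bilinear bilinear_jordan) (simp_all add: jordan_der_def)

lemma op_exp_inner:
  fixes T :: "'v::euclidean_space \<Rightarrow> 'v"
  assumes "linear T" "\<And>u v. T u \<bullet> v = - (u \<bullet> T v)"
  shows "op_exp T u \<bullet> op_exp T v = u \<bullet> v"
proof -
  have "op_exp (\<lambda>_. 0) (u \<bullet> v) = op_exp T u \<bullet> op_exp T v"
    using assms bounded_bilinear_inner
    by (intro op_exp_bilinear) (simp_all add: bilinear_conv_bounded_bilinear linear_zero)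
  then show ?thesis by (simp add: op_exp_zero)
qed

lemma der_group_linear: "h \<in> der_group \<Longrightarrow> linear h"
proof (induction rule: der_group.induct)
  case (der_group_exp D h)
  then show ?case by (metis linear_compose linear_op_exp jordan_der_linear)
qed (rule linear_id)

lemma der_group_aut: "h \<in> der_group \<Longrightarrow> h \<in> jordan_aut"
proof (induction rule: der_group.induct)
  case (der_group_exp D h)
  note D = jordan_der_linear[OF der_group_exp(1)]
  from der_group_exp show ?case
    using linear_compose[OF _ linear_op_exp[OF D], of h] bij_comp[OF _ bij_op_exp[OF D], of h]
    by (simp add: jordan_aut_def op_exp_jordan o_def)
qed (simp add: jordan_aut_def linear_id flip: id_def)

lemma der_group_jordan: "h \<in> der_group \<Longrightarrow> h (X \<circ>\<^sub>J Y) = h X \<circ>\<^sub>J h Y"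
  using der_group_aut by (auto simp: jordan_aut_def)

lemma der_group_inner: "h \<in> der_group \<Longrightarrow> h X \<bullet> h Y = X \<bullet> Y"
  by (induction rule: der_group.induct) (simp_all add: op_exp_inner jordan_der_linear jordan_der_skew)

lemma der_group_unit: "h \<in> der_group \<Longrightarrow> h unit_mat = unit_mat"
proof (induction rule: der_group.induct)
  case (der_group_exp D h)
  have "op_exp D unit_mat = unit_mat"
    using op_exp_curve[OF jordan_der_linear[OF der_group_exp(1)], of "\<lambda>_. unit_mat"]
    by (simp add: jordan_der_unit[OF der_group_exp(1)])
  then show ?case using der_group_exp by simp
qed simp

lemma der_group_inverse:
  assumes "h \<in> der_group"
  obtains h' where "h' \<in> der_group" "\<And>X. h' (h X) = X" "\<And>X. h (h' X) = X"
proof -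
  from assms have "\<exists>h'\<in>der_group. \<forall>X. h' (h X) = X \<and> h (h' X) = X"
  proof (induction rule: der_group.induct)
    case der_group_id
    show ?case by (rule bexI[of _ id]) (simp_all add: der_group.der_group_id)
  next
    case (der_group_exp D h)
    then obtain h' where h': "h' \<in> der_group" "\<forall>X. h' (h X) = X \<and> h (h' X) = X" by blast
    have D: "linear D" "(\<lambda>X. - D X) \<in> jordan_der"
      using jordan_der_scale[OF der_group_exp(1), of "-1"] jordan_der_linear[OF der_group_exp(1)] by simp_all
    have "op_exp D (op_exp (\<lambda>X. - D X) X) = X" for X
      using op_exp_minus[OF linear_compose_neg[OF D(1)]] by simp
    then show ?case
      using h' D der_group_comp[OF h'(1) op_exp_der_group[OF D(2)]]
      by (intro bexI[of _ "h' \<circ> op_exp (\<lambda>X. - D X)"]) (simp_all add: op_exp_minus)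
  qed
  then show ?thesis using that by blast
qed

lemma der_group_cyc: "h \<in> der_group \<Longrightarrow> (\<lambda>X. cyc (h (cyc (cyc X)))) \<in> der_group"
proof (induction rule: der_group.induct)
  case der_group_id
  then show ?case using der_group.der_group_id by (simp add: cyc_cyc_cyc id_def)
next
  case (der_group_exp D h)
  let ?D = "\<lambda>X. cyc (D (cyc (cyc X)))"
  have D: "?D \<in> jordan_der" by (rule jordan_der_cyc[OF der_group_exp(1)])
  have "cyc (op_exp D X) = op_exp ?D (cyc X)" for X
    by (rule op_exp_intertwine)
      (simp_all add: linear_cyc jordan_der_linear der_group_exp(1) D cyc_cyc_cyc)
  then show ?case
    using der_group.der_group_exp[OF D der_group_exp(3)] by (simp add: o_def)
qed

section \<open>The spectral theorem\<close>

lemma op_exp_subspace: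
  fixes T :: "'v::euclidean_space \<Rightarrow> 'v"
  assumes T: "linear T" and S: "subspace S" and inv: "\<And>v. v \<in> S \<Longrightarrow> T v \<in> S" and v: "v \<in> S"
  shows "op_exp T v \<in> S"
proof -
  have "(T ^^ k) v \<in> S" for k by (induction k) (simp_all add: v inv)
  then have "(\<Sum>k<n. (1 / fact k) *\<^sub>R (T ^^ k) v) \<in> S" for n
    by (intro subspace_sum subspace_scale S)
  moreover have "(\<lambda>n. \<Sum>k<n. (1 / fact k) *\<^sub>R (T ^^ k) v) \<longlonglongrightarrow> op_exp T v"
    using summable_op_exp[of T 1 v] T unfolding op_exp_def
    by (intro summable_LIMSEQ) (simp add: linear_conv_bounded_linear)
  ultimately show ?thesis
    by (rule closed_sequentially[OF closed_subspace[OF S]])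
qed

lemma op_exp_kernel:
  fixes T :: "'v::euclidean_space \<Rightarrow> 'v"
  assumes "linear T" "T v = 0"
  shows "op_exp T v = v"
  using op_exp_curve[of T "\<lambda>_. v"] assms by simp

text \<open>In the plane of \<open>hm 1 (-1) 0 0 0 0\<close> and \<open>hm 0 0 0 0 0 a\<close>,
  \<open>rot_gen a\<close> generates rotation at angular speed 2, hence the division of
  \<open>\<theta>\<close> by 2.\<close>

lemma rotation:
  fixes a :: "'a::comp_alg" and \<theta> :: real
  assumes a: "a \<bullet> a = 1"
  defines "D \<equiv> \<lambda>X. (\<theta> / 2) *\<^sub>R rot_gen a X"
  shows "op_exp D (hm (r * cos \<phi>) (- (r * cos \<phi>)) 0 0 0 ((r * sin \<phi>) *\<^sub>R a))
    = hm (r * cos (\<phi> - \<theta>)) (- (r * cos (\<phi> - \<theta>))) 0 0 0 ((r * sin (\<phi> - \<theta>)) *\<^sub>R a)"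
proof -
  have D: "linear D"
    unfolding D_def by (intro linear_compose_scale_right jordan_der_linear rot_gen_der)
  let ?u = "hm 1 (-1) 0 0 0 0 :: 'a herm" and ?w = "hm 0 0 0 0 0 a"
  let ?\<gamma> = "\<lambda>t. (r * cos (\<phi> - t * \<theta>)) *\<^sub>R ?u + (r * sin (\<phi> - t * \<theta>)) *\<^sub>R ?w"
  have "D (?\<gamma> t) = (r * sin (\<phi> - t * \<theta>) * \<theta>) *\<^sub>R ?u + (- (r * cos (\<phi> - t * \<theta>) * \<theta>)) *\<^sub>R ?w" for t
    by (simp add: D_def hm_arith rot_gen_hm a)
  moreover have "(?\<gamma> has_vector_derivative
      (r * sin (\<phi> - t * \<theta>) * \<theta>) *\<^sub>R ?u + (- (r * cos (\<phi> - t * \<theta>) * \<theta>)) *\<^sub>R ?w) (at t)" for t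
    by (rule derivative_eq_intros refl | simp)+ (simp add: mult_ac)
  ultimately have "op_exp D (?\<gamma> 0) = ?\<gamma> 1"
    by (intro op_exp_curve[OF D]) simp
  then show ?thesis by (simp add: hm_arith)
qed

lemma rotate_away:
  fixes x :: "'a::comp_alg"
  obtains h d' e' x' y' where "h \<in> der_group" "h (hm d e f x y z) = hm d' e' f x' y' 0"
    "x = 0 \<Longrightarrow> y = 0 \<Longrightarrow> x' = 0 \<and> y' = 0"
proof (cases "z = 0")
  case True
  then show ?thesis using that[OF der_group_id] by simp
next
  case False
  define a where "a = (1 / norm z) *\<^sub>R z"
  have a: "a \<bullet> a = 1" "z = norm z *\<^sub>R a"
    using False by (simp_all add: a_def dot_square_norm power2_eq_square)
  \<comment> \<open>Polar coordinates in the plane of \<open>rotation\<close>; turning by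
    \<open>\<phi>\<close> moves the point to the axis on which the (1,2) entry vanishes.\<close>
  obtain r \<phi> where p: "(d - e) / 2 = r * cos \<phi>" "norm z = r * sin \<phi>"
    using polar_Ex by blast
  define D where "D = (\<lambda>X. (\<phi> / 2) *\<^sub>R rot_gen a X)"
  have D: "D \<in> jordan_der" by (simp add: D_def rot_gen_der jordan_der_scale)
  \<comment> \<open>What remains outside the plane has equal first diagonal entries and zero (1,2)
    entry. The rotation preserves this shape, so adding it back creates no (1,2) entry.\<close>
  let ?m = "(d + e) / 2"
  let ?S = "{hm m m q u v 0 | m q u v. True} :: 'a herm set"
  have "subspace ?S"
    by (auto simp: subspace_def hm_arith)
  moreover have "D X \<in> ?S" if "X \<in> ?S" for X
    using that by (auto simp: D_def rot_gen_hm hm_arith)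
  ultimately have "op_exp D (hm ?m ?m f x y 0) \<in> ?S"
    by (intro op_exp_subspace jordan_der_linear D) blast+
  then obtain m q u v where S: "op_exp D (hm ?m ?m f x y 0) = hm m m q u v 0" by blast
  \<comment> \<open>Pairing with the fixed idempotent at (3,3) reads off the third diagonal
    entry.\<close>
  have "op_exp D (hm ?m ?m f x y 0) \<bullet> op_exp D (hm 0 0 1 0 0 0) = f"
    unfolding der_group_inner[OF op_exp_der_group[OF D]] by (simp add: inner_hm)
  moreover have "op_exp D (hm 0 0 1 0 0 0) = hm 0 0 1 0 0 0"
    by (rule op_exp_kernel) (simp_all add: jordan_der_linear D, simp add: D_def rot_gen_hm hm_arith)
  ultimately have q: "q = f" by (simp add: S inner_hm)
  have uv: "u = 0 \<and> v = 0" if "x = 0" "y = 0"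
  proof -
    have "op_exp D (hm ?m ?m f x y 0) = hm ?m ?m f x y 0"
      by (rule op_exp_kernel) (simp_all add: jordan_der_linear D, simp add: D_def rot_gen_hm hm_arith that)
    then show ?thesis using S that by simp
  qed
  have 1: "op_exp D (hm (r * cos \<phi>) (- (r * cos \<phi>)) 0 0 0 z) = hm r (- r) 0 0 0 0"
    using rotation[OF a(1), of \<phi> r \<phi>] by (simp add: D_def a(2)[symmetric] flip: p(2))
  have "hm d e f x y z = hm (r * cos \<phi>) (- (r * cos \<phi>)) 0 0 0 z + hm ?m ?m f x y 0"
    by (simp add: hm_arith field_simps flip: p(1))
  then have "op_exp D (hm d e f x y z) = hm r (- r) 0 0 0 0 + hm m m f u v 0"
    by (simp only: linear_add[OF linear_op_exp[OF jordan_der_linear[OF D]]] 1 S q)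
  then have "op_exp D (hm d e f x y z) = hm (r + m) (m - r) f u v 0"
    by (simp add: hm_arith)
  then show ?thesis using that[OF op_exp_der_group[OF D]] uv by blast
qed

section \<open>Conjugacy to diagonal matrices\<close>

definition der_conj :: "'a::comp_alg herm \<Rightarrow> 'a herm \<Rightarrow> bool" where
  "der_conj X Y \<longleftrightarrow> (\<exists>h\<in>der_group. h X = Y)"

lemma der_conj_refl: "der_conj X X"
  unfolding der_conj_def by (metis der_group_id id_apply)

lemma der_conj_trans [trans]: "der_conj X Y \<Longrightarrow> der_conj Y Z \<Longrightarrow> der_conj X Z"
  unfolding der_conj_def using der_group_comp by (metis comp_apply)

lemma der_conj_cyc: "der_conj X Y \<Longrightarrow> der_conj (cyc X) (cyc Y)"
  unfolding der_conj_def using der_group_cyc by (metis cyc_cyc_cyc)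

text \<open>The rotation by \<open>pi\<close> negates the difference of the two entries and fixes
  their mean.\<close>

lemma der_conj_swap: "der_conj (hm d e f 0 0 0) (hm e d f 0 0 (0 :: 'a::comp_alg))"
proof -
  let ?D = "\<lambda>X. (pi / 2) *\<^sub>R rot_gen (1 :: 'a) X"
  let ?m = "(d + e) / 2"
  have D: "?D \<in> jordan_der" by (simp add: rot_gen_der jordan_der_scale)
  have 1: "op_exp ?D (hm ?m ?m f 0 0 0) = hm ?m ?m f 0 0 0"
    by (rule op_exp_kernel[OF jordan_der_linear[OF D]]) (simp add: rot_gen_hm hm_arith)
  have 2: "op_exp ?D (hm ((d - e) / 2) (- ((d - e) / 2)) 0 0 0 0)
      = hm (- ((d - e) / 2)) ((d - e) / 2) 0 0 0 0"
    using rotation[of "1 :: 'a" pi "(d - e) / 2" 0] by simp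
  have "hm d e f 0 0 (0 :: 'a) = hm ((d - e) / 2) (- ((d - e) / 2)) 0 0 0 0 + hm ?m ?m f 0 0 0"
    by (simp add: hm_arith field_simps)
  then have "op_exp ?D (hm d e f 0 0 0) = hm (- ((d - e) / 2)) ((d - e) / 2) 0 0 0 0 + hm ?m ?m f 0 0 0"
    by (simp only: linear_add[OF linear_op_exp[OF jordan_der_linear[OF D]]] 1 2)
  also have "\<dots> = hm e d f 0 0 0" by (simp add: hm_arith field_simps)
  finally have "op_exp ?D (hm d e f 0 0 0) = hm e d f 0 0 0" .
  then show ?thesis using op_exp_der_group[OF D] der_conj_def by blast
qed

lemma der_conj_swap23: "der_conj (hm d e f 0 0 0) (hm d f e 0 0 (0 :: 'a::comp_alg))"
  using der_conj_swap[of e f d, THEN der_conj_cyc, THEN der_conj_cyc] by (simp add: cyc_hm)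

lemma der_conj_diag_mono:
  obtains d' e' f' where "der_conj (hm d e f 0 0 (0 :: 'a::comp_alg)) (hm d' e' f' 0 0 0)" "d' \<le> e'" "e' \<le> f'"
proof -
  note s = der_conj_swap[where 'a='a] der_conj_swap23[where 'a='a]
  have "\<exists>d' e' f'. der_conj (hm d e f 0 0 (0 :: 'a)) (hm d' e' f' 0 0 0) \<and> d' \<le> e' \<and> e' \<le> f'"
  proof -
    consider "d \<le> e" "e \<le> f" | "d \<le> f" "f \<le> e" | "e \<le> d" "d \<le> f" | "e \<le> f" "f \<le> d"
      | "f \<le> d" "d \<le> e" | "f \<le> e" "e \<le> d" by linarith
    then show ?thesis
      using der_conj_refl s der_conj_trans[OF s(1) s(2)] der_conj_trans[OF s(2) s(1)]
        der_conj_trans[OF s(1) der_conj_trans[OF s(2) s(1)]]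
      by cases blast+
  qed
  then show ?thesis using that by blast
qed

lemma der_conj_diag:
  fixes x :: "'a::comp_alg"
  assumes "x = 0 \<or> y = 0" "y = 0 \<or> z = 0" "x = 0 \<or> z = 0"
  obtains d' e' f' where "der_conj (hm d e f x y z) (hm d' e' f' 0 0 0)"
proof -
  have *: "\<exists>d' e' f'. der_conj (hm d e f 0 0 z) (hm d' e' f' 0 0 0)" for d e f and z :: 'a
    using rotate_away[of d e f 0 0 z] der_conj_def by metis
  have "\<exists>d' e' f'. der_conj (hm d e f 0 y 0) (hm d' e' f' 0 0 0)" for d e f and y :: 'a
    using *[of f d e y] der_conj_cyc[of "hm f d e 0 0 y"] by (metis cyc_hm)
  moreover have "\<exists>d' e' f'. der_conj (hm d e f x 0 0) (hm d' e' f' 0 0 0)" for d e f and x :: 'a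
    using calculation[of f d e x] der_conj_cyc[of "hm f d e 0 x 0"] by (metis cyc_hm)
  ultimately show ?thesis using * assms that by metis
qed

text \<open>The points of the projective plane over the coefficient algebra.\<close>

definition prim_idem :: "'a::comp_alg herm set" where
  "prim_idem = {p. p \<circ>\<^sub>J p = p \<and> p \<bullet> unit_mat = 1}"

lemma der_group_prim_idem: "h \<in> der_group \<Longrightarrow> p \<in> prim_idem \<Longrightarrow> h p \<in> prim_idem"
  using der_group_inner[of h p unit_mat]
  by (simp add: prim_idem_def der_group_unit flip: der_group_jordan)

lemma prim_idem_conj:
  fixes p :: "'a::comp_alg herm"
  assumes "p \<in> prim_idem"
  shows "der_conj p (hm 1 0 0 0 0 0)"
proof -
  have inv: "q \<in> prim_idem" if "der_conj p q" for q
    using that assms der_group_prim_idem by (auto simp: der_conj_def)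
  obtain d e f x y z where p: "p = hm d e f x y z" by (rule hm_cases)
  obtain d e x y where 1: "der_conj p (hm d e f x y 0)"
    using rotate_away[of d e f x y z] p der_conj_def by metis
  \<comment> \<open>This is the (1,2) entry of the idempotent equation; absence of zero divisors
    then leaves at most one off-diagonal entry.\<close>
  then have "aconj (x * y) = 0"
    using inv[OF 1] by (simp add: prim_idem_def square_hm)
  then have "x * y = 0" by (metis aconj_conj aconj_zero)
  then have "x = 0 \<or> y = 0" by (rule alg_no_zero_divisors)
  then obtain d e f where 2: "der_conj p (hm d e f 0 0 0)"
    using der_conj_diag[of x y 0 d e f] 1 der_conj_trans by metis
  then have "hm d e f 0 0 (0 :: 'a) \<in> prim_idem" by (rule inv)
  then have "d\<^sup>2 = d" "e\<^sup>2 = e" "f\<^sup>2 = f" "d + e + f = 1"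
    by (simp_all add: prim_idem_def square_hm Diag_hm inner_hm)
  then have "d = 1 \<and> e = 0 \<and> f = 0 \<or> d = 0 \<and> e = 1 \<and> f = 0 \<or> d = 0 \<and> e = 0 \<and> f = 1"
    by (auto simp: power2_eq_square)
  moreover have "der_conj (hm 0 0 1 0 0 0) (hm 1 0 0 0 0 (0 :: 'a))"
    using der_conj_trans[OF der_conj_swap23 der_conj_swap] .
  ultimately show ?thesis
    using 2 der_conj_trans[OF 2] der_conj_swap by metis
qed

lemma compact_prim_idem: "compact (prim_idem :: 'a::comp_alg herm set)"
proof -
  have "p \<bullet> p = 1" if "p \<in> prim_idem" for p :: "'a herm"
    using that inner_square_unit[of p] by (simp add: prim_idem_def)
  then have "bounded (prim_idem :: 'a herm set)"
    by (intro boundedI[of _ 1]) (simp add: norm_eq_sqrt_inner)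
  moreover have "closed (prim_idem :: 'a herm set)"
    unfolding prim_idem_def
    by (intro closed_Collect_conj closed_Collect_eq continuous_intros
        bounded_bilinear.continuous_on[OF bounded_bilinear_jordan])
  ultimately show ?thesis by (simp add: compact_eq_bounded_closed)
qed

text \<open>A primitive idempotent maximizing \<open>X \<bullet> p\<close> may be moved to \<open>Diag 1 0 0\<close>; there the derivatives
  of the functional along derivations vanish, which kills the entries \<open>(1,2)\<close> and \<open>(3,1)\<close>.\<close>

theorem spectral:
  fixes X :: "'a::comp_alg herm"
  obtains h d e f where "h \<in> der_group" "h X = Diag d e f" "d \<le> e" "e \<le> f"
proof -
  let ?e = "hm 1 0 0 0 0 0 :: 'a herm"
  have "?e \<in> prim_idem" by (simp add: prim_idem_def square_hm Diag_hm inner_hm)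
  then have "\<exists>p\<in>prim_idem. \<forall>q\<in>prim_idem. X \<bullet> q \<le> X \<bullet> p"
    by (intro continuous_attains_sup compact_prim_idem continuous_intros) auto
  then obtain p where p: "p \<in> prim_idem" "\<And>q. q \<in> prim_idem \<Longrightarrow> X \<bullet> q \<le> X \<bullet> p"
    by blast
  obtain h where h: "h \<in> der_group" "h p = ?e"
    using prim_idem_conj[OF p(1)] by (auto simp: der_conj_def)
  obtain h' where h': "h' \<in> der_group" "\<And>X. h' (h X) = X" "\<And>X. h (h' X) = X"
    by (rule der_group_inverse[OF h(1)]) blast
  have max: "h X \<bullet> q \<le> h X \<bullet> ?e" if "q \<in> prim_idem" for q
    using p(2)[OF der_group_prim_idem[OF h'(1) that]] der_group_inner[OF h(1), of X]
    by (metis h(2) h'(3))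
  have crit: "h X \<bullet> D ?e = 0" if D: "D \<in> jordan_der" for D
  proof -
    let ?E = "\<lambda>t. op_exp (\<lambda>X. t *\<^sub>R D X) ?e"
    have "(?E has_vector_derivative D (?E 0)) (at 0)"
      by (rule op_exp_has_vector_derivative[OF jordan_der_linear[OF D]])
    then have "(?E has_vector_derivative D ?e) (at 0)" by (simp add: op_exp_zero)
    then have "((\<lambda>t. h X \<bullet> ?E t) has_real_derivative h X \<bullet> D ?e) (at 0)"
      using bounded_linear.has_vector_derivative[OF bounded_linear_inner_right]
      by (simp add: has_real_derivative_iff_has_vector_derivative)
    moreover have "h X \<bullet> ?E t \<le> h X \<bullet> ?E 0" for t
      using max[OF der_group_prim_idem[OF op_exp_der_group[OF jordan_der_scale[OF D]] \<open>?e \<in> prim_idem\<close>]]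
      by (simp add: op_exp_zero)
    ultimately show ?thesis
      by (intro DERIV_local_max[of _ _ 0 1]) auto
  qed
  obtain d e f x y z where hX: "h X = hm d e f x y z" by (rule hm_cases)
  have "z \<bullet> z = 0"
    using crit[OF rot_gen_der[of z]] by (simp add: hX rot_gen_hm inner_hm)
  moreover have "y \<bullet> y = 0"
    using crit[OF jordan_der_cyc[OF rot_gen_der[of y]]] by (simp add: hX cyc_hm rot_gen_hm inner_hm)
  ultimately obtain d' e' f' where 1: "der_conj (h X) (hm d' e' f' 0 0 0)"
    using der_conj_diag[of x y z d e f] by (auto simp: hX)
  obtain d e f where 2: "der_conj (hm d' e' f' 0 0 (0 :: 'a)) (hm d e f 0 0 0)" "d \<le> e" "e \<le> f"
    by (rule der_conj_diag_mono)
  have "der_conj X (h X)" using h(1) by (auto simp: der_conj_def)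
  then have "der_conj X (hm d e f 0 0 0)" using 1 2(1) der_conj_trans by metis
  then show ?thesis using that 2(2,3) by (auto simp: der_conj_def Diag_hm)
qed

section \<open>The Jordan identity\<close>

lemma jordan_identity:
  fixes X Y :: "'a::comp_alg herm"
  shows "(X \<circ>\<^sub>J X) \<circ>\<^sub>J (X \<circ>\<^sub>J Y) = X \<circ>\<^sub>J ((X \<circ>\<^sub>J X) \<circ>\<^sub>J Y)"
proof -
  have diag: "(D \<circ>\<^sub>J D) \<circ>\<^sub>J (D \<circ>\<^sub>J Z) = D \<circ>\<^sub>J ((D \<circ>\<^sub>J D) \<circ>\<^sub>J Z)" if "D = Diag d e f" for D Z :: "'a herm" and d e f
    by (cases Z rule: hm_cases) (simp add: that Diag_hm jordan_hm mult_ac)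
  obtain h d e f where h: "h \<in> der_group" "h X = Diag d e f" by (rule spectral)
  have "h ((X \<circ>\<^sub>J X) \<circ>\<^sub>J (X \<circ>\<^sub>J Y)) = h (X \<circ>\<^sub>J ((X \<circ>\<^sub>J X) \<circ>\<^sub>J Y))"
    using diag[OF h(2)] by (simp add: der_group_jordan[OF h(1)])
  moreover have "inj h" using der_group_aut[OF h(1)] by (simp add: jordan_aut_def bij_def)
  ultimately show ?thesis by (blast dest: injD)
qed

text \<open>Full polarization of [L P, L (P^2)] = 0: inclusion-exclusion over sums of
  \<open>X\<close>, \<open>U\<close>, \<open>V\<close> isolates the part linear in each. The factor
  2 in the proof comes from the two orders in a mixed square.\<close>

lemma jordan_identity_linear:
  fixes X U V Y :: "'a::comp_alg herm"
  shows "X \<circ>\<^sub>J ((U \<circ>\<^sub>J V) \<circ>\<^sub>J Y) - (U \<circ>\<^sub>J V) \<circ>\<^sub>J (X \<circ>\<^sub>J Y)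
    + (U \<circ>\<^sub>J ((X \<circ>\<^sub>J V) \<circ>\<^sub>J Y) - (X \<circ>\<^sub>J V) \<circ>\<^sub>J (U \<circ>\<^sub>J Y))
    + (V \<circ>\<^sub>J ((X \<circ>\<^sub>J U) \<circ>\<^sub>J Y) - (X \<circ>\<^sub>J U) \<circ>\<^sub>J (V \<circ>\<^sub>J Y)) = 0"
    (is "?L = 0")
proof -
  define c where "c = (\<lambda>P Q :: 'a herm. P \<circ>\<^sub>J (Q \<circ>\<^sub>J Y) - Q \<circ>\<^sub>J (P \<circ>\<^sub>J Y))"
  have c: "c P (P \<circ>\<^sub>J P) = 0" for P
    using jordan_identity[of P Y] by (simp add: c_def)
  have add: "c (P + Q) R = c P R + c Q R" "c R (P + Q) = c R P + c R Q" for P Q R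
    by (simp_all add: c_def jordan_bilin algebra_simps)
  have "2 *\<^sub>R (c X (U \<circ>\<^sub>J V) + c U (X \<circ>\<^sub>J V) + c V (X \<circ>\<^sub>J U)) =
      c (X + U + V) ((X + U + V) \<circ>\<^sub>J (X + U + V))
      - c (X + U) ((X + U) \<circ>\<^sub>J (X + U)) - c (X + V) ((X + V) \<circ>\<^sub>J (X + V)) - c (U + V) ((U + V) \<circ>\<^sub>J (U + V))
      + c X (X \<circ>\<^sub>J X) + c U (U \<circ>\<^sub>J U) + c V (V \<circ>\<^sub>J V)"
    by (simp add: add jordan_bilin scaleR_2 jordan_commute[of V U] jordan_commute[of V X] jordan_commute[of U X])
  then show ?thesis by (simp add: c) (simp add: c_def)
qed

lemma inner_derivation:
  fixes X U :: "'a::comp_alg herm"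
  shows "(\<lambda>Y. X \<circ>\<^sub>J (U \<circ>\<^sub>J Y) - U \<circ>\<^sub>J (X \<circ>\<^sub>J Y)) \<in> jordan_der" (is "?D \<in> _")
proof -
  have "?D (V \<circ>\<^sub>J Y) = ?D V \<circ>\<^sub>J Y + V \<circ>\<^sub>J ?D Y" for V Y
  proof -
    \<comment> \<open>\<open>?Q\<close> runs over the three splittings of \<open>U\<close>,
      \<open>V\<close>, \<open>X\<close>, \<open>Y\<close> into pairs and is therefore symmetric.
      The linearized identity, acting on \<open>X\<close> and on \<open>U\<close>, makes both
      \<open>?A\<close> and \<open>?B\<close> equal to it, and the defect of the Leibniz rule is
      their difference.\<close>
    let ?Q = "(U \<circ>\<^sub>J V) \<circ>\<^sub>J (Y \<circ>\<^sub>J X) + (Y \<circ>\<^sub>J V) \<circ>\<^sub>J (U \<circ>\<^sub>J X) + (Y \<circ>\<^sub>J U) \<circ>\<^sub>J (V \<circ>\<^sub>J X)"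
    let ?A = "Y \<circ>\<^sub>J ((U \<circ>\<^sub>J V) \<circ>\<^sub>J X) + U \<circ>\<^sub>J ((Y \<circ>\<^sub>J V) \<circ>\<^sub>J X) + V \<circ>\<^sub>J ((Y \<circ>\<^sub>J U) \<circ>\<^sub>J X)"
    let ?B = "Y \<circ>\<^sub>J ((X \<circ>\<^sub>J V) \<circ>\<^sub>J U) + X \<circ>\<^sub>J ((Y \<circ>\<^sub>J V) \<circ>\<^sub>J U) + V \<circ>\<^sub>J ((Y \<circ>\<^sub>J X) \<circ>\<^sub>J U)"
    have "?A - ?Q = 0"
      by (subst jordan_identity_linear[of Y U V X, symmetric]) (simp add: algebra_simps)
    moreover have "?B - ?Q = 0"
      by (subst jordan_identity_linear[of Y X V U, symmetric]) (simp add: algebra_simps jordan_commute)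
    moreover have "?D (V \<circ>\<^sub>J Y) - (?D V \<circ>\<^sub>J Y + V \<circ>\<^sub>J ?D Y) = (?B - ?Q) - (?A - ?Q)"
      by (simp add: jordan_bilin algebra_simps jordan_commute)
    ultimately have "?D (V \<circ>\<^sub>J Y) - (?D V \<circ>\<^sub>J Y + V \<circ>\<^sub>J ?D Y) = 0" by (simp only: diff_zero)
    then show ?thesis by (simp only: right_minus_eq)
  qed
  moreover have "linear ?D" by (rule linearI) (simp_all add: jordan_bilin algebra_simps)
  ultimately show ?thesis by (simp add: jordan_der_def)
qed

section \<open>Positive semidefinite matrices\<close>

text \<open>The dual of the cone of squares: a family of inequalities linear in \<open>X\<close>,
  hence closed and convex, and free of any choice of diagonal form.\<close>

definition psd :: "'a::comp_alg herm \<Rightarrow> bool" where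
  "psd X \<longleftrightarrow> (\<forall>Z. 0 \<le> X \<bullet> (Z \<circ>\<^sub>J Z))"

lemma psd_Diag: "psd (Diag d e f :: 'a::comp_alg herm) \<longleftrightarrow> 0 \<le> d \<and> 0 \<le> e \<and> 0 \<le> f"
proof
  assume "psd (Diag d e f :: 'a herm)"
  then have "0 \<le> (Diag d e f :: 'a herm) \<bullet> (Z \<circ>\<^sub>J Z)" for Z by (simp add: psd_def)
  from this[of "hm 1 0 0 0 0 0"] this[of "hm 0 1 0 0 0 0"] this[of "hm 0 0 1 0 0 0"]
  show "0 \<le> d \<and> 0 \<le> e \<and> 0 \<le> f" by (simp add: square_hm Diag_hm inner_hm)
next
  assume d: "0 \<le> d \<and> 0 \<le> e \<and> 0 \<le> f"
  show "psd (Diag d e f :: 'a herm)"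
    unfolding psd_def
  proof
    show "0 \<le> Diag d e f \<bullet> (Z \<circ>\<^sub>J Z)" for Z :: "'a herm"
      using d by (cases Z rule: hm_cases) (simp add: square_hm Diag_hm inner_hm)
  qed
qed

lemma psd_der_group: "h \<in> der_group \<Longrightarrow> psd (h X) \<longleftrightarrow> psd X"
proof -
  assume h: "h \<in> der_group"
  then obtain h' where h': "h' \<in> der_group" "\<And>X. h' (h X) = X" "\<And>X. h (h' X) = X"
    by (rule der_group_inverse) blast
  have "h X \<bullet> (h Z \<circ>\<^sub>J h Z) = X \<bullet> (Z \<circ>\<^sub>J Z)" for Z
    by (simp add: der_group_inner h flip: der_group_jordan[OF h])
  then show "psd (h X) \<longleftrightarrow> psd X"
    unfolding psd_def by (metis h'(3))
qed

lemma psd_square: "psd (Y \<circ>\<^sub>J Y)"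
proof -
  obtain h d e f where h: "h \<in> der_group" "h Y = Diag d e f" by (rule spectral)
  have "h (Y \<circ>\<^sub>J Y) = Diag (d * d) (e * e) (f * f)"
    using h by (simp add: der_group_jordan Diag_hm jordan_hm)
  then show ?thesis using psd_der_group[OF h(1), of "Y \<circ>\<^sub>J Y"] by (simp add: psd_Diag)
qed

lemma psd_scale_add:
  "psd X \<Longrightarrow> 0 \<le> r \<Longrightarrow> psd (r *\<^sub>R X)" "psd X \<Longrightarrow> psd Y \<Longrightarrow> psd (X + Y)"
  by (simp_all add: psd_def inner_add_left)

lemma psd_unit: "psd unit_mat"
  by (simp add: psd_Diag)

section \<open>Positive definite matrices and their boundary\<close>

lemma jordan_aut_unit:
  fixes g :: "'a::comp_alg herm \<Rightarrow> 'a herm"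
  assumes "g \<in> jordan_aut"
  shows "g unit_mat = unit_mat"
proof -
  obtain W where W: "g W = unit_mat"
    using assms by (metis (mono_tags, lifting) bij_pointE jordan_aut_def mem_Collect_eq)
  have "g (unit_mat \<circ>\<^sub>J W) = g unit_mat \<circ>\<^sub>J g W"
    using assms by (simp add: jordan_aut_def)
  then show ?thesis
    by (simp only: W jordan_unit jordan_commute[of _ unit_mat])
qed

lemma Lambda_pos_iff:
  fixes X :: "'a::comp_alg herm"
  shows "X \<in> Lambda_pos \<longleftrightarrow> X \<bullet> unit_mat = 1 \<and> (\<exists>\<epsilon>>0. psd (X - \<epsilon> *\<^sub>R unit_mat))"
proof -
  have "(\<exists>l1 l2 l3. eigenvalues X l1 l2 l3 \<and> 0 < l1) \<longleftrightarrow> (\<exists>\<epsilon>>0. psd (X - \<epsilon> *\<^sub>R unit_mat))"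
  proof
    assume "\<exists>l1 l2 l3. eigenvalues X l1 l2 l3 \<and> 0 < l1"
    then obtain l1 l2 l3 g where l: "0 < l1" "l1 \<le> l2" "l2 \<le> l3" and g: "g \<in> jordan_aut" "g X = Diag l1 l2 l3"
      by (auto simp: eigenvalues_def)
    \<comment> \<open>A square root of the diagonal form of
      \<open>X - l1 *\<^sub>R unit_mat\<close>. Every automorphism transports squares, while
      isometry is established only on \<open>der_group\<close>; so this difference is exhibited as a
      square.\<close>
    let ?W = "Diag 0 (sqrt (l2 - l1)) (sqrt (l3 - l1)) :: 'a herm"
    obtain V where V: "g V = ?W"
      using g(1) by (metis (mono_tags, lifting) bij_pointE jordan_aut_def mem_Collect_eq)
    have lin: "linear g" using g(1) by (simp add: jordan_aut_def)
    have "g (X - l1 *\<^sub>R unit_mat) = ?W \<circ>\<^sub>J ?W"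
      using l
      by (simp add: linear_diff[OF lin] linear_scale[OF lin] g(2) jordan_aut_unit[OF g(1)])
        (simp add: Diag_hm hm_arith jordan_hm)
    also have "\<dots> = g (V \<circ>\<^sub>J V)" using g(1) V by (simp add: jordan_aut_def)
    finally have "g (X - l1 *\<^sub>R unit_mat) = g (V \<circ>\<^sub>J V)" .
    moreover have "inj g" using g(1) by (simp add: jordan_aut_def bij_def)
    ultimately have "X - l1 *\<^sub>R unit_mat = V \<circ>\<^sub>J V" by (blast dest: injD)
    then show "\<exists>\<epsilon>>0. psd (X - \<epsilon> *\<^sub>R unit_mat)" using l(1) psd_square by metis
  next
    assume "\<exists>\<epsilon>>0. psd (X - \<epsilon> *\<^sub>R unit_mat)"
    then obtain \<epsilon> where e: "\<epsilon> > 0" "psd (X - \<epsilon> *\<^sub>R unit_mat)" by blast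
    obtain h l1 l2 l3 where h: "h \<in> der_group" "h X = Diag l1 l2 l3" "l1 \<le> l2" "l2 \<le> l3" by (rule spectral)
    note lin = der_group_linear[OF h(1)]
    have "psd (h (X - \<epsilon> *\<^sub>R unit_mat))" using e(2) psd_der_group[OF h(1)] by blast
    moreover have "h (X - \<epsilon> *\<^sub>R unit_mat) = Diag (l1 - \<epsilon>) (l2 - \<epsilon>) (l3 - \<epsilon>)"
      by (simp add: linear_diff[OF lin] linear_scale[OF lin] h(2) der_group_unit[OF h(1)])
        (simp add: Diag_hm hm_arith)
    ultimately have "0 < l1" using e(1) by (simp add: psd_Diag)
    then show "\<exists>l1 l2 l3. eigenvalues X l1 l2 l3 \<and> 0 < l1"
      using h der_group_aut[OF h(1)] by (auto simp: eigenvalues_def)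
  qed
  then show ?thesis by (auto simp: Lambda_pos_def trace_slice_iff)
qed

lemma closed_psd: "closed {X :: 'a::comp_alg herm. psd X}"
  unfolding psd_def by (intro closed_Collect_all closed_Collect_le continuous_intros)

lemma Lambda_pos_subset: "(Lambda_pos :: 'a::comp_alg herm set) \<subseteq> trace_slice 1"
  by (auto simp: Lambda_pos_def)

lemma openin_Lambda_pos: "openin (top_of_set (trace_slice 1)) (Lambda_pos :: 'a::comp_alg herm set)"
  unfolding openin_contains_ball
proof (intro conjI ballI Lambda_pos_subset)
  fix X :: "'a herm" assume "X \<in> Lambda_pos"
  then obtain \<epsilon> where e: "\<epsilon> > 0" "psd (X - \<epsilon> *\<^sub>R unit_mat)" by (auto simp: Lambda_pos_iff)
  obtain K where K: "K > 0" "\<And>Y Z :: 'a herm. norm (Y \<circ>\<^sub>J Z) \<le> norm Y * norm Z * K"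
    using bounded_bilinear.pos_bounded[OF bounded_bilinear_jordan] by blast
  \<comment> \<open>With this radius the perturbation costs at most half of the gap
    \<open>\<epsilon>\<close>: the norm of Z^2 is at most \<open>K\<close> times the squared norm of
    Z, which is the pairing of Z^2 with the unit.\<close>
  have "Y \<in> Lambda_pos" if Y: "Y \<in> ball X (\<epsilon> / (2 * K))" "Y \<in> trace_slice 1" for Y
  proof -
    have "psd (Y - (\<epsilon> / 2) *\<^sub>R unit_mat)"
      unfolding psd_def
    proof
      fix Z :: "'a herm"
      have "\<bar>(X - Y) \<bullet> (Z \<circ>\<^sub>J Z)\<bar> \<le> norm (X - Y) * norm (Z \<circ>\<^sub>J Z)"
        by (rule Cauchy_Schwarz_ineq2)
      also have "\<dots> \<le> (\<epsilon> / (2 * K)) * (norm Z * norm Z * K)"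
        using Y(1) K e(1) by (intro mult_mono) (auto simp: dist_norm)
      also have "\<dots> = (\<epsilon> / 2) * (unit_mat \<bullet> (Z \<circ>\<^sub>J Z))"
        using K(1) inner_square_unit[of Z] by (simp add: inner_commute dot_square_norm power2_eq_square)
      finally have "(X - Y) \<bullet> (Z \<circ>\<^sub>J Z) \<le> (\<epsilon> / 2) * (unit_mat \<bullet> (Z \<circ>\<^sub>J Z))" by simp
      moreover have "0 \<le> (X - \<epsilon> *\<^sub>R unit_mat) \<bullet> (Z \<circ>\<^sub>J Z)" using e(2) by (simp add: psd_def)
      ultimately show "0 \<le> (Y - (\<epsilon> / 2) *\<^sub>R unit_mat) \<bullet> (Z \<circ>\<^sub>J Z)"
        by (simp add: inner_diff_left algebra_simps)
    qed
    then show ?thesis using Y(2) e(1) by (auto simp: Lambda_pos_iff trace_slice_iff intro!: exI[of _ "\<epsilon> / 2"])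
  qed
  then show "\<exists>r>0. ball X r \<inter> trace_slice 1 \<subseteq> Lambda_pos"
    using e(1) K(1) by (intro exI[of _ "\<epsilon> / (2 * K)"]) auto
qed

lemma psd_in_closure:
  fixes X :: "'a::comp_alg herm"
  assumes "psd X" "X \<bullet> unit_mat = 1"
  shows "X \<in> closure Lambda_pos"
  unfolding closure_sequential
proof (intro exI conjI allI)
  let ?t = "\<lambda>n. inverse (real (Suc n))"
  \<comment> \<open>Points on the segment between \<open>X\<close> and the trace-one multiple of the
    unit, whose share provides the gap.\<close>
  let ?Y = "\<lambda>n. (1 - ?t n) *\<^sub>R X + (?t n / 3) *\<^sub>R unit_mat"
  show "?Y n \<in> Lambda_pos" for n
  proof -
    have "unit_mat \<bullet> (unit_mat :: 'a herm) = 3" by (simp add: Diag_hm inner_hm)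
    then have "?Y n \<bullet> unit_mat = 1" using assms(2) by (simp add: inner_add_left)
    moreover have "0 \<le> 1 - ?t n" by (simp add: divide_simps)
    then have "psd (?Y n - (?t n / 3) *\<^sub>R unit_mat)"
      using psd_scale_add(1)[OF assms(1)] by simp
    moreover have "?t n / 3 > 0" by simp
    ultimately show ?thesis unfolding Lambda_pos_iff by blast
  qed
  have "?Y \<longlonglongrightarrow> (1 - 0) *\<^sub>R X + (0 / 3) *\<^sub>R unit_mat"
    by (intro tendsto_intros LIMSEQ_inverse_real_of_nat) simp
  then show "?Y \<longlonglongrightarrow> X" by simp
qed

lemma Sigma_bd_iff:
  fixes X :: "'a::comp_alg herm"
  shows "X \<in> Sigma_bd \<longleftrightarrow> X \<bullet> unit_mat = 1 \<and> psd X \<and> \<not> (\<exists>\<epsilon>>0. psd (X - \<epsilon> *\<^sub>R unit_mat))"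
proof -
  have "psd Y" if Y: "Y \<in> Lambda_pos" for Y :: "'a herm"
  proof -
    obtain \<epsilon> where e: "\<epsilon> > 0" "psd (Y - \<epsilon> *\<^sub>R unit_mat)"
      using Y unfolding Lambda_pos_iff by blast
    then show ?thesis
      using psd_scale_add(2)[OF e(2) psd_scale_add(1)[OF psd_unit, of \<epsilon>]] by simp
  qed
  then have "closure Lambda_pos \<subseteq> {X :: 'a herm. psd X}"
    by (intro closure_minimal closed_psd) auto
  moreover have "trace_slice 1 \<inter> Lambda_pos = (Lambda_pos :: 'a herm set)"
    using Lambda_pos_subset by blast
  ultimately have "X \<in> top_of_set (trace_slice 1) closure_of Lambda_pos \<longleftrightarrow> X \<bullet> unit_mat = 1 \<and> psd X"
    using psd_in_closure[of X] by (auto simp: closure_of_subtopology trace_slice_iff)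
  then show ?thesis
    using openin_Lambda_pos[where 'a='a]
    by (auto simp: Sigma_bd_def frontier_of_def interior_of_openin Lambda_pos_iff)
qed

lemma Sigma_bd_conj:
  fixes X :: "'a::comp_alg herm"
  assumes "X \<in> Sigma_bd"
  obtains h \<theta> where "h \<in> der_group" "h X = Diag ((cos \<theta>)\<^sup>2) ((sin \<theta>)\<^sup>2) 0"
proof -
  have X: "X \<bullet> unit_mat = 1" "psd X" "\<not> (\<exists>\<epsilon>>0. psd (X - \<epsilon> *\<^sub>R unit_mat))"
    using assms by (simp_all add: Sigma_bd_iff)
  obtain h d e f where h: "h \<in> der_group" "h X = Diag d e f" "d \<le> e" "e \<le> f" by (rule spectral)
  note lin = der_group_linear[OF h(1)]
  have "0 \<le> d" using X(2) psd_der_group[OF h(1), of X] by (simp add: h(2) psd_Diag)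
  \<comment> \<open>If the smallest eigenvalue \<open>d\<close> were positive, it would serve as the
    excluded \<open>\<epsilon>\<close>.\<close>
  moreover have "psd (X - d *\<^sub>R unit_mat)"
  proof -
    have "h (X - d *\<^sub>R unit_mat) = Diag 0 (e - d) (f - d)"
      by (simp add: linear_diff[OF lin] linear_scale[OF lin] h(2) der_group_unit[OF h(1)])
        (simp add: Diag_hm hm_arith)
    then show ?thesis using psd_der_group[OF h(1), of "X - d *\<^sub>R unit_mat"] h(3,4) by (simp add: psd_Diag)
  qed
  ultimately have d: "d = 0" using X(3) le_less by metis
  have "h X \<bullet> h unit_mat = 1" using X(1) der_group_inner[OF h(1)] by simp
  then have "e + f = 1" by (simp add: h(2) der_group_unit[OF h(1)] d) (simp add: Diag_hm inner_hm)
  then have "(sqrt e)\<^sup>2 + (sqrt f)\<^sup>2 = 1" using h(3,4) d by simp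
  then obtain \<theta> where t: "sqrt e = cos \<theta>" "sqrt f = sin \<theta>"
    using sincos_total_pi_half[of "sqrt e" "sqrt f"] h(3,4) d by auto
  have "der_conj X (hm 0 e f 0 0 0)" using h d by (auto simp: der_conj_def Diag_hm)
  also have "der_conj \<dots> (hm e 0 f 0 0 0)" by (rule der_conj_swap)
  also have "der_conj \<dots> (hm e f 0 0 0 0)" by (rule der_conj_swap23)
  finally have "der_conj X (Diag e f 0)" by (simp add: Diag_hm)
  moreover have "e = (cos \<theta>)\<^sup>2" "f = (sin \<theta>)\<^sup>2"
    using h(3,4) d by (simp_all flip: t)
  ultimately show ?thesis using that by (auto simp: der_conj_def)
qed

section \<open>The Jordan triple product\<close>

text \<open>The Jordan triple product; for associative coefficients it is (a b c + c b a) /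
  2.\<close>

definition jtrip :: "'a::conj_algebra herm \<Rightarrow> 'a herm \<Rightarrow> 'a herm \<Rightarrow> 'a herm" where
  "jtrip a b c = (a \<circ>\<^sub>J b) \<circ>\<^sub>J c + (c \<circ>\<^sub>J b) \<circ>\<^sub>J a - (a \<circ>\<^sub>J c) \<circ>\<^sub>J b"

lemma jtrip_linear:
  "jtrip (a + a') b c = jtrip a b c + jtrip a' b c" "jtrip (a - a') b c = jtrip a b c - jtrip a' b c"
  "jtrip a (b + b') c = jtrip a b c + jtrip a b' c" "jtrip a (b - b') c = jtrip a b c - jtrip a b' c"
  "jtrip a b (c + c') = jtrip a b c + jtrip a b c'" "jtrip a b (c - c') = jtrip a b c - jtrip a b c'"
  by (simp_all add: jtrip_def jordan_bilin algebra_simps)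

lemma jordan_der_jtrip:
  assumes "D \<in> jordan_der"
  shows "D (jtrip a b c) = jtrip (D a) b c + jtrip a (D b) c + jtrip a b (D c)"
  by (simp add: jtrip_def jordan_bilin jordan_der_mult[OF assms] linear_add[OF jordan_der_linear[OF assms]]
      linear_diff[OF jordan_der_linear[OF assms]] algebra_simps)

text \<open>The linearized Jordan identity combined with the derivation [L a, L b]. Multiplications
  fail the Leibniz rule only by the sign in the middle slot.\<close>

lemma jordan_mult_jtrip:
  fixes X :: "'a::comp_alg herm"
  shows "X \<circ>\<^sub>J jtrip a b c = jtrip (X \<circ>\<^sub>J a) b c - jtrip a (X \<circ>\<^sub>J b) c + jtrip a b (X \<circ>\<^sub>J c)"
proof -
  note J = jordan_identity_linear[of X a b c] and D = jordan_der_mult[OF inner_derivation[of a b], of X c]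
  have "X \<circ>\<^sub>J jtrip a b c - (jtrip (X \<circ>\<^sub>J a) b c - jtrip a (X \<circ>\<^sub>J b) c + jtrip a b (X \<circ>\<^sub>J c)) =
    (X \<circ>\<^sub>J ((a \<circ>\<^sub>J b) \<circ>\<^sub>J c) - (a \<circ>\<^sub>J b) \<circ>\<^sub>J (X \<circ>\<^sub>J c)
    + (a \<circ>\<^sub>J ((X \<circ>\<^sub>J b) \<circ>\<^sub>J c) - (X \<circ>\<^sub>J b) \<circ>\<^sub>J (a \<circ>\<^sub>J c))
    + (b \<circ>\<^sub>J ((X \<circ>\<^sub>J a) \<circ>\<^sub>J c) - (X \<circ>\<^sub>J a) \<circ>\<^sub>J (b \<circ>\<^sub>J c)))
    - (a \<circ>\<^sub>J (b \<circ>\<^sub>J (X \<circ>\<^sub>J c)) - b \<circ>\<^sub>J (a \<circ>\<^sub>J (X \<circ>\<^sub>J c))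
      - ((a \<circ>\<^sub>J (b \<circ>\<^sub>J X) - b \<circ>\<^sub>J (a \<circ>\<^sub>J X)) \<circ>\<^sub>J c + X \<circ>\<^sub>J (a \<circ>\<^sub>J (b \<circ>\<^sub>J c) - b \<circ>\<^sub>J (a \<circ>\<^sub>J c))))"
    by (simp add: jtrip_def jordan_bilin algebra_simps jordan_commute)
  also have "\<dots> = 0" by (simp only: J D diff_self diff_zero)
  finally show ?thesis by (simp only: right_minus_eq)
qed

section \<open>The products on the complexification\<close>

definition cmul :: "'a::conj_algebra hermC \<Rightarrow> 'a hermC \<Rightarrow> 'a hermC" where
  "cmul u v = (fst u \<circ>\<^sub>J fst v - snd u \<circ>\<^sub>J snd v, fst u \<circ>\<^sub>J snd v + snd u \<circ>\<^sub>J fst v)"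

definition cj :: "'a::conj_algebra hermC \<Rightarrow> 'a hermC" where
  "cj u = (fst u, - snd u)"

text \<open>Conjugation makes the middle slot antilinear: the sign of \<open>\<i>\<close> changes
  there and cancels the minus of \<open>jordan_mult_jtrip\<close>, so each \<open>iL X\<close> obeys
  the Leibniz rule.\<close>

definition ctrip :: "'a::conj_algebra hermC \<Rightarrow> 'a hermC \<Rightarrow> 'a hermC \<Rightarrow> 'a hermC" where
  "ctrip u v w = cmul (cmul u (cj v)) w + cmul (cmul w (cj v)) u - cmul (cmul u w) (cj v)"

lemma ctrip_jtrip:
  "ctrip (a, a') (b, b') (c, c') =
    (jtrip a b c + jtrip a b' c' + jtrip a' b' c - jtrip a' b c',
     jtrip a' b c - jtrip a b' c + jtrip a b c' + jtrip a' b' c')"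
  by (simp add: ctrip_def cmul_def cj_def jtrip_def jordan_bilin algebra_simps)

lemma bilinear_cmul: "bilinear cmul"
  unfolding bilinear_def by (intro conjI allI linearI) (simp_all add: cmul_def jordan_bilin algebra_simps)

lemma linear_cj: "linear cj"
  by (rule linearI) (simp_all add: cj_def)

lemma cmul_commute: "cmul u v = cmul v u"
  by (simp add: cmul_def jordan_commute add.commute)

lemma linear_scaleC: "linear (scaleC c)"
  by (rule linearI) (simp_all add: scaleC_def algebra_simps)

lemma scaleC_scaleC: "scaleC c (scaleC d u) = scaleC (c * d) u"
  by (simp add: scaleC_def algebra_simps)

lemma cmul_scaleC: "cmul (scaleC c u) v = scaleC c (cmul u v)"
  by (simp add: cmul_def scaleC_def jordan_bilin algebra_simps)

lemma cj_scaleC: "cj (scaleC c u) = scaleC (cnj c) (cj u)"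
  by (simp add: cj_def scaleC_def)

lemma ctrip_scaleC:
  fixes u :: "'a::conj_algebra hermC"
  shows "ctrip (scaleC c u) (scaleC d v) w = scaleC (c * cnj d) (ctrip u v w)"
proof -
  have "cmul u' (scaleC c v') = scaleC c (cmul u' v')" for c and u' v' :: "'a hermC"
    by (metis cmul_commute cmul_scaleC)
  then show ?thesis
    by (simp add: ctrip_def cj_scaleC cmul_scaleC scaleC_scaleC linear_add[OF linear_scaleC]
        linear_diff[OF linear_scaleC] mult.commute)
qed

lemma inner_scaleC_self: "scaleC c u \<bullet> scaleC c u = (cmod c)\<^sup>2 * (u \<bullet> u)"
  by (cases u) (simp add: scaleC_def inner_diff_left inner_diff_right inner_add_left inner_add_right
      cmod_def inner_commute power2_eq_square algebra_simps)

section \<open>The compact group\<close>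

lemma lie_hatE:
  assumes "T \<in> lie_hat"
  obtains D X where "D \<in> jordan_der" "X \<in> trace_slice 0"
    "\<And>a a'. T (a, a') = (D a - X \<circ>\<^sub>J a', D a' + X \<circ>\<^sub>J a)"
  using assms by (auto simp: lie_hat_def cextend_def iL_def scaleC_def)

lemma lie_hat_linear:
  fixes T :: "'a::comp_alg hermC \<Rightarrow> 'a hermC"
  assumes "T \<in> lie_hat"
  shows "linear T"
proof -
  obtain D X where D: "D \<in> jordan_der" and T: "\<And>a a'. T (a, a') = (D a - X \<circ>\<^sub>J a', D a' + X \<circ>\<^sub>J a)"
    by (rule lie_hatE[OF assms]) blast
  note D = jordan_der_linear[OF D]
  show ?thesis
    by (rule linearI) (auto simp: T linear_add[OF D] linear_scale[OF D] jordan_bilin algebra_simps)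
qed

lemma lie_hat_scaleC:
  fixes T :: "'a::comp_alg hermC \<Rightarrow> 'a hermC"
  assumes "T \<in> lie_hat"
  shows "scaleC c (T u) = T (scaleC c u)"
proof -
  obtain D X where D: "D \<in> jordan_der" and T: "\<And>a a'. T (a, a') = (D a - X \<circ>\<^sub>J a', D a' + X \<circ>\<^sub>J a)"
    by (rule lie_hatE[OF assms]) blast
  note D = jordan_der_linear[OF D]
  show ?thesis
    by (cases u) (simp add: T scaleC_def linear_add[OF D] linear_diff[OF D] linear_scale[OF D] jordan_bilin algebra_simps)
qed

text \<open>Derivations are skew and multiplications self-adjoint; the factor \<open>\<i>\<close>
  makes the latter skew as well.\<close>

lemma lie_hat_skew:
  fixes T :: "'a::comp_alg hermC \<Rightarrow> 'a hermC"
  assumes "T \<in> lie_hat"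
  shows "T u \<bullet> v = - (u \<bullet> T v)"
proof -
  obtain D X where D: "D \<in> jordan_der" and T: "\<And>a a'. T (a, a') = (D a - X \<circ>\<^sub>J a', D a' + X \<circ>\<^sub>J a)"
    by (rule lie_hatE[OF assms]) blast
  show ?thesis
    by (cases u, cases v)
      (simp add: T inner_diff_left inner_diff_right inner_add_left inner_add_right jordan_der_skew[OF D] inner_jordan)
qed

lemma lie_hat_ctrip:
  fixes T :: "'a::comp_alg hermC \<Rightarrow> 'a hermC"
  assumes "T \<in> lie_hat"
  shows "T (ctrip u v w) = ctrip (T u) v w + ctrip u (T v) w + ctrip u v (T w)"
proof -
  obtain D X where D: "D \<in> jordan_der" and T: "\<And>a a'. T (a, a') = (D a - X \<circ>\<^sub>J a', D a' + X \<circ>\<^sub>J a)"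
    by (rule lie_hatE[OF assms]) blast
  note L = jordan_der_linear[OF D]
  show ?thesis
    by (cases u, cases v, cases w)
      (simp add: T ctrip_jtrip linear_add[OF L] linear_diff[OF L] jordan_der_jtrip[OF D] jtrip_linear
        jordan_bilin jordan_mult_jtrip)
qed

lemma op_exp_ctrip:
  fixes T :: "'a::comp_alg hermC \<Rightarrow> 'a hermC"
  assumes T: "T \<in> lie_hat"
  shows "op_exp T (ctrip u v w) = ctrip (op_exp T u) (op_exp T v) (op_exp T w)"
proof -
  let ?E = "\<lambda>v t. op_exp (\<lambda>w. t *\<^sub>R T w) v"
  let ?\<gamma> = "\<lambda>t. ctrip (?E u t) (?E v t) (?E w t)"
  have d: "(?E v has_vector_derivative T (?E v t)) (at t)" for v t
    by (rule op_exp_has_vector_derivative[OF lie_hat_linear[OF T]])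
  have m: "((\<lambda>t. cmul (f t) (g t)) has_vector_derivative (cmul (f t) g' + cmul f' (g t))) (at t)"
    if "(f has_vector_derivative f') (at t)" "(g has_vector_derivative g') (at t)"
    for f g :: "real \<Rightarrow> 'a hermC" and f' g' t
    using bounded_bilinear.has_vector_derivative[OF _ that] bilinear_cmul
    by (metis bilinear_conv_bounded_bilinear)
  have j: "((\<lambda>t. cj (f t)) has_vector_derivative cj f') (at t)"
    if "(f has_vector_derivative f') (at t)" for f :: "real \<Rightarrow> 'a hermC" and f' t
    using bounded_linear.has_vector_derivative[OF _ that] linear_cj
    by (metis linear_conv_bounded_linear)
  note b = bilinear_ladd[OF bilinear_cmul] bilinear_radd[OF bilinear_cmul]
  have "(?\<gamma> has_vector_derivative ctrip (T (?E u t)) (?E v t) (?E w t) + ctrip (?E u t) (T (?E v t)) (?E w t)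
      + ctrip (?E u t) (?E v t) (T (?E w t))) (at t)" for t
    unfolding ctrip_def
    by (rule has_vector_derivative_eq_rhs, (rule has_vector_derivative_add has_vector_derivative_diff m j d)+)
      (simp add: b algebra_simps)
  then have "(?\<gamma> has_vector_derivative T (?\<gamma> t)) (at t)" for t
    by (simp only: lie_hat_ctrip[OF T])
  then show ?thesis
    using op_exp_curve[OF lie_hat_linear[OF T], of ?\<gamma>] by (simp add: op_exp_zero)
qed

lemma G_hat_linear: "g \<in> G_hat \<Longrightarrow> linear (g :: 'a::comp_alg hermC \<Rightarrow> _)"
proof (induction rule: G_hat.induct)
  case (G_hat_exp T g)
  then show ?case by (metis linear_compose linear_op_exp lie_hat_linear)
qed (rule linear_id)

lemma G_hat_bij: "g \<in> G_hat \<Longrightarrow> bij (g :: 'a::comp_alg hermC \<Rightarrow> _)"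
proof (induction rule: G_hat.induct)
  case (G_hat_exp T g)
  then show ?case by (metis bij_comp bij_op_exp lie_hat_linear)
qed (rule bij_id)

lemma G_hat_scaleC: "g \<in> G_hat \<Longrightarrow> g (scaleC c u) = scaleC c (g u :: 'a::comp_alg hermC)"
proof (induction rule: G_hat.induct)
  case (G_hat_exp T g)
  have "scaleC c (op_exp T v) = op_exp T (scaleC c v)" for v
    by (rule op_exp_intertwine)
      (simp_all add: linear_scaleC lie_hat_linear lie_hat_scaleC G_hat_exp(1))
  then show ?case using G_hat_exp by simp
qed simp

lemma G_hat_inner: "g \<in> G_hat \<Longrightarrow> g u \<bullet> g v = u \<bullet> (v :: 'a::comp_alg hermC)"
  by (induction rule: G_hat.induct) (simp_all add: op_exp_inner lie_hat_linear lie_hat_skew)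

lemma G_hat_ctrip: "g \<in> G_hat \<Longrightarrow> g (ctrip u v w) = ctrip (g u) (g v) (g w :: 'a::comp_alg hermC)"
  by (induction rule: G_hat.induct) (simp_all add: op_exp_ctrip)

lemma G_hat_comp: "g \<in> G_hat \<Longrightarrow> h \<in> G_hat \<Longrightarrow> g \<circ> h \<in> G_hat"
  by (induction g rule: G_hat.induct) (simp_all add: G_hat_exp flip: o_assoc)

lemma der_group_G_hat:
  fixes h :: "'a::comp_alg herm \<Rightarrow> 'a herm"
  assumes "h \<in> der_group"
  shows "cextend h \<in> G_hat"
  using assms
proof (induction rule: der_group.induct)
  case der_group_id
  show ?case using G_hat_id by (simp add: cextend_def id_def)
next
  case (der_group_exp D h)
  let ?T = "\<lambda>u. cextend D u + iL 0 u"
  note D = jordan_der_linear[OF der_group_exp(1)]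
  have "0 \<in> (trace_slice 0 :: 'a herm set)" by (simp add: trace_slice_iff)
  then have T: "?T \<in> lie_hat"
    using der_group_exp(1) unfolding lie_hat_def by blast
  have T': "fst (?T u) = D (fst u)" "snd (?T u) = D (snd u)" for u
    by (simp_all add: cextend_def iL_def scaleC_def jordan_bilin)
  have "fst (op_exp ?T u) = op_exp D (fst u)" for u
    by (rule op_exp_intertwine) (rule linear_fst lie_hat_linear[OF T] D T'(1))+
  moreover have "snd (op_exp ?T u) = op_exp D (snd u)" for u
    by (rule op_exp_intertwine) (rule linear_snd lie_hat_linear[OF T] D T'(2))+
  ultimately have "cextend (op_exp D \<circ> h) = op_exp ?T \<circ> cextend h"
    by (auto simp: fun_eq_iff cextend_def prod_eq_iff)
  then show ?case using G_hat_exp[OF T der_group_exp(3)] by (simp only:)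
qed

section \<open>The map to the traceless matrices\<close>

abbreviation base_vec :: "'a::conj_algebra hermC" where
  "base_vec \<equiv> (Diag 1 0 0, 0)"

text \<open>Minimality of the idempotent. The coefficient is expressed by real inner products, so
  that complex linear isometries preserving \<open>ctrip\<close> carry the identity along.\<close>

lemma ctrip_base:
  fixes w :: "'a::comp_alg hermC"
  shows "ctrip base_vec w base_vec = scaleC (Complex (base_vec \<bullet> w) (base_vec \<bullet> scaleC \<i> w)) base_vec"
proof -
  have "jtrip (Diag 1 0 0) b (Diag 1 0 0) = (Diag 1 0 0 \<bullet> b) *\<^sub>R Diag 1 0 0" for b :: "'a herm"
    by (cases b rule: hm_cases) (simp add: jtrip_def Diag_hm jordan_hm hm_arith inner_hm, simp flip: scaleR_add_left)
  moreover have "jtrip 0 b c = 0" "jtrip b c 0 = 0" for b c :: "'a herm"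
    by (simp_all add: jtrip_def jordan_bilin)
  ultimately show ?thesis by (cases w) (simp add: ctrip_jtrip scaleC_def)
qed

text \<open>Idempotence collapses the triple product {e e b} to multiplication of b by e, and
  \<open>E0\<close> is e minus a third of the unit.\<close>

lemma iL_E0: "iL E0 w = scaleC \<i> (ctrip base_vec base_vec w - (1/3) *\<^sub>R (w :: 'a::comp_alg hermC))"
proof -
  have "jtrip (Diag 1 0 0) (Diag 1 0 0) b - (1/3) *\<^sub>R b = E0 \<circ>\<^sub>J b" for b :: "'a herm"
    by (cases b rule: hm_cases) (simp add: jtrip_def E0_def Diag_hm jordan_hm hm_arith flip: scaleR_diff_left)
  moreover have "jtrip 0 b c = 0" "jtrip b 0 c = 0" for b c :: "'a herm"
    by (simp_all add: jtrip_def jordan_bilin)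
  ultimately show ?thesis
    by (cases w) (simp add: iL_def ctrip_jtrip scaleC_def cextend_def)
qed

lemma Ad_E0:
  fixes g :: "'a::comp_alg hermC \<Rightarrow> 'a hermC"
  assumes g: "g \<in> G_hat"
  shows "Ad g (iL E0) = (\<lambda>w. scaleC \<i> (ctrip (g base_vec) (g base_vec) w - (1/3) *\<^sub>R w))"
proof
  fix w
  have "g (inv g w) = w" using G_hat_bij[OF g] by (simp add: bij_is_surj surj_f_inv_f)
  then show "Ad g (iL E0) w = scaleC \<i> (ctrip (g base_vec) (g base_vec) w - (1/3) *\<^sub>R w)"
    by (simp add: Ad_def iL_E0 G_hat_scaleC[OF g] linear_diff[OF G_hat_linear[OF g]]
        linear_scale[OF G_hat_linear[OF g]] G_hat_ctrip[OF g])
qed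

lemma G_hat_base_pt: "g \<in> G_hat \<Longrightarrow> g ` base_pt = proj_pt (g (base_vec :: 'a::comp_alg hermC))"
  by (auto simp: base_pt_def proj_pt_def G_hat_scaleC image_image)

lemma inner_base_vec: "base_vec \<bullet> (base_vec :: 'a::comp_alg hermC) = 1"
  by (simp add: Diag_hm inner_hm)

text \<open>Since \<open>G_hat\<close> acts by isometries, two representatives \<open>g base_vec\<close>, \<open>h base_vec\<close> of the same
  point differ by a complex number of modulus one, which cancels in the triple product.\<close>

lemma adjoint_embedding_eq:
  fixes g :: "'a::comp_alg hermC \<Rightarrow> 'a hermC"
  assumes g: "g \<in> G_hat"
  shows "adjoint_embedding (g ` base_pt) =
    (\<lambda>w. scaleC \<i> (ctrip (g base_vec) (g base_vec) w - (1/3) *\<^sub>R w))"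
  unfolding adjoint_embedding_def
proof (rule the_equality)
  show "\<exists>h\<in>G_hat. g ` base_pt = h ` base_pt \<and>
      (\<lambda>w. scaleC \<i> (ctrip (g base_vec) (g base_vec) w - (1/3) *\<^sub>R w)) = Ad h (iL E0)"
    using g Ad_E0[OF g] by metis
next
  fix T assume "\<exists>h\<in>G_hat. g ` base_pt = h ` base_pt \<and> T = Ad h (iL E0)"
  then obtain h where h: "h \<in> G_hat" "g ` base_pt = h ` base_pt" "T = Ad h (iL E0)" by blast
  have "scaleC 1 (h base_vec) \<in> proj_pt (h base_vec)" by (auto simp: proj_pt_def)
  then have "scaleC 1 (h base_vec) \<in> proj_pt (g base_vec)"
    using h(2) G_hat_base_pt[OF g] G_hat_base_pt[OF h(1)] by simp
  then obtain c where c: "h base_vec = scaleC c (g base_vec)"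
    by (auto simp: proj_pt_def scaleC_def)
  have "g base_vec \<bullet> g base_vec = 1" "h base_vec \<bullet> h base_vec = 1"
    by (simp_all only: G_hat_inner[OF g] G_hat_inner[OF h(1)] inner_base_vec)
  then have "(cmod c)\<^sup>2 = 1"
    using inner_scaleC_self[of c "g base_vec"] by (simp flip: c)
  then have "c * cnj c = 1" by (metis complex_norm_square of_real_1)
  then have "ctrip (h base_vec) (h base_vec) w = ctrip (g base_vec) (g base_vec) w" for w
    by (simp add: c ctrip_scaleC) (simp add: scaleC_def)
  then show "T = (\<lambda>w. scaleC \<i> (ctrip (g base_vec) (g base_vec) w - (1/3) *\<^sub>R w))"
    by (simp add: h(3) Ad_E0[OF h(1)])
qed

text \<open>Uniqueness of the decomposition: evaluated at the unit matrix, the operator has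
  imaginary part \<open>X\<close>.\<close>

lemma lie_proj_eq:
  fixes X :: "'a::comp_alg herm"
  assumes "D \<in> jordan_der" "X \<in> trace_slice 0"
  shows "lie_proj (\<lambda>u. cextend D u + iL X u) = X"
  unfolding lie_proj_def
proof (rule the_equality)
  show "X \<in> trace_slice 0 \<and> (\<exists>D'\<in>jordan_der. (\<lambda>u. cextend D u + iL X u) = (\<lambda>u. cextend D' u + iL X u))"
    using assms by blast
next
  fix X' assume "X' \<in> trace_slice 0 \<and> (\<exists>D'\<in>jordan_der. (\<lambda>u. cextend D u + iL X u) = (\<lambda>u. cextend D' u + iL X' u))"
  then obtain D' where D': "D' \<in> jordan_der" "(\<lambda>u. cextend D u + iL X u) = (\<lambda>u. cextend D' u + iL X' u)" by blast
  from fun_cong[OF D'(2), of "(unit_mat, 0)"] show "X' = X"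
    using linear_0[OF jordan_der_linear[OF assms(1)]] linear_0[OF jordan_der_linear[OF D'(1)]]
    by (simp add: cextend_def iL_def scaleC_def jordan_commute[of _ unit_mat] jordan_unit)
qed

text \<open>With \<open>u = Y + \<i> Z\<close>, the operator \<open>ctrip u u\<close> is \<open>L (Y\<^sup>2 + Z\<^sup>2) - 2 \<i> [L Y, L Z]\<close>, and
  commutators of multiplications are derivations.\<close>

lemma sigma_map_eq:
  fixes g :: "'a::comp_alg hermC \<Rightarrow> 'a hermC"
  assumes g: "g \<in> G_hat" and u: "g base_vec = (Y, Z)"
  shows "sigma_map (g ` base_pt) = Y \<circ>\<^sub>J Y + Z \<circ>\<^sub>J Z - (1/3) *\<^sub>R unit_mat"
    and "(Y \<circ>\<^sub>J Y + Z \<circ>\<^sub>J Z) \<bullet> unit_mat = 1"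
proof -
  let ?X = "Y \<circ>\<^sub>J Y + Z \<circ>\<^sub>J Z - (1/3) *\<^sub>R unit_mat"
  let ?D = "\<lambda>W. 2 *\<^sub>R (Y \<circ>\<^sub>J (Z \<circ>\<^sub>J W) - Z \<circ>\<^sub>J (Y \<circ>\<^sub>J W))"
  have "(Y, Z) \<bullet> (Y, Z) = 1"
    using G_hat_inner[OF g, of base_vec base_vec] unfolding u inner_base_vec .
  then show tr: "(Y \<circ>\<^sub>J Y + Z \<circ>\<^sub>J Z) \<bullet> unit_mat = 1"
    by (simp add: inner_add_left inner_square_unit)
  have "unit_mat \<bullet> (unit_mat :: 'a herm) = 3" by (simp add: Diag_hm inner_hm)
  then have X: "?X \<in> trace_slice 0"
    using tr by (simp add: trace_slice_iff inner_diff_left)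
  have D: "?D \<in> jordan_der" by (rule jordan_der_scale[OF inner_derivation])
  have "W \<circ>\<^sub>J unit_mat = W" for W :: "'a herm" by (simp only: jordan_commute[of W] jordan_unit)
  then have "scaleC \<i> (ctrip (Y, Z) (Y, Z) w - (1/3) *\<^sub>R w) = cextend ?D w + iL ?X w" for w
    by (cases w) (simp add: ctrip_jtrip jtrip_def scaleC_def cextend_def iL_def jordan_bilin jordan_unit
        jordan_commute algebra_simps scaleR_2)
  then show "sigma_map (g ` base_pt) = ?X"
    unfolding sigma_map_def adjoint_embedding_eq[OF g] u using lie_proj_eq[OF D X] by simp
qed

section \<open>The image\<close>

text \<open>\<open>sq\<close> and \<open>pr\<close> are the real and imaginary parts of u^2 = tr(u)
  u with u = Y + \<i> Z, a form of the condition that u has rank at most one. With \<open>Y\<close>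
  diagonal its minors can be examined entry by entry.\<close>

lemma null_idem_diag:
  fixes x :: "'a::comp_alg"
  assumes Y: "Y = hm d e f 0 0 0" and Z: "Z = hm a b c x y z"
    and sq: "Y \<circ>\<^sub>J Y - Z \<circ>\<^sub>J Z = (Y \<bullet> unit_mat) *\<^sub>R Y - (Z \<bullet> unit_mat) *\<^sub>R Z"
    and pr: "2 *\<^sub>R (Y \<circ>\<^sub>J Z) = (Y \<bullet> unit_mat) *\<^sub>R Z + (Z \<bullet> unit_mat) *\<^sub>R Y" and "Y \<noteq> 0"
  obtains p where "p \<in> prim_idem" "Y \<circ>\<^sub>J p = 0" "Z \<circ>\<^sub>J p = 0"
proof -
  have "d\<^sup>2 - (a\<^sup>2 + y \<bullet> y + z \<bullet> z) = (d + e + f) * d - (a + b + c) * a"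
    "e\<^sup>2 - (b\<^sup>2 + z \<bullet> z + x \<bullet> x) = (d + e + f) * e - (a + b + c) * b"
    "f\<^sup>2 - (c\<^sup>2 + x \<bullet> x + y \<bullet> y) = (d + e + f) * f - (a + b + c) * c"
    using sq unfolding Y Z by (simp_all add: square_hm Diag_hm inner_hm hm_arith)
  \<comment> \<open>Real parts of the vanishing principal 2x2 minors of u; \<open>l\<close> below
    gives the imaginary parts.\<close>
  then have q: "e * f = b * c - x \<bullet> x" "d * f = a * c - y \<bullet> y" "d * e = a * b - z \<bullet> z"
    by (simp_all add: algebra_simps power2_eq_square)
  have "2 * (d * a) = (d + e + f) * a + (a + b + c) * d"
    "2 * (e * b) = (d + e + f) * b + (a + b + c) * e"
    "2 * (f * c) = (d + e + f) * c + (a + b + c) * f"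
    and off: "(e + f) *\<^sub>R x = (d + e + f) *\<^sub>R x" "(f + d) *\<^sub>R y = (d + e + f) *\<^sub>R y" "(d + e) *\<^sub>R z = (d + e + f) *\<^sub>R z"
    using pr unfolding Y Z by (simp_all add: jordan_hm Diag_hm inner_hm hm_arith)
  then have l: "e * a + d * b = 0" "f * a + d * c = 0" "f * b + e * c = 0"
    by (simp_all add: algebra_simps)
  have o: "d = 0 \<or> x = 0" "e = 0 \<or> y = 0" "f = 0 \<or> z = 0"
    using off by (auto simp: scaleR_add_left)
  \<comment> \<open>If no diagonal entry of \<open>Y\<close> vanished, \<open>l\<close> and
    \<open>o\<close> would force \<open>Z\<close> to be zero, against \<open>q\<close>.\<close>
  have "d = 0 \<or> e = 0 \<or> f = 0"
  proof (rule ccontr)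
    assume n: "\<not> (d = 0 \<or> e = 0 \<or> f = 0)"
    have "2 * (d * f * b) = f * (e * a + d * b) + d * (f * b + e * c) - e * (f * a + d * c)"
      by (simp add: algebra_simps)
    then have "b = 0" using l n by simp
    then show False using l n q o by auto
  qed
  moreover have "d \<noteq> 0 \<or> e \<noteq> 0 \<or> f \<noteq> 0" using \<open>Y \<noteq> 0\<close> by (auto simp: Y hm_arith)
  \<comment> \<open>Some row vanishes in both \<open>Y\<close> and \<open>Z\<close>; the diagonal
    idempotent with that index is the one sought.\<close>
  ultimately have "d = 0 \<and> a = 0 \<and> y = 0 \<and> z = 0 \<or> e = 0 \<and> b = 0 \<and> z = 0 \<and> x = 0 \<or> f = 0 \<and> c = 0 \<and> x = 0 \<and> y = 0"
    using l o q by auto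
  then show ?thesis
    using that[of "hm 1 0 0 0 0 0"] that[of "hm 0 1 0 0 0 0"] that[of "hm 0 0 1 0 0 0"]
    unfolding Y Z by (auto simp: prim_idem_def jordan_hm Diag_hm inner_hm hm_arith)
qed

lemma null_idem_nonzero:
  fixes Y Z :: "'a::comp_alg herm"
  assumes sq: "Y \<circ>\<^sub>J Y - Z \<circ>\<^sub>J Z = (Y \<bullet> unit_mat) *\<^sub>R Y - (Z \<bullet> unit_mat) *\<^sub>R Z"
    and pr: "2 *\<^sub>R (Y \<circ>\<^sub>J Z) = (Y \<bullet> unit_mat) *\<^sub>R Z + (Z \<bullet> unit_mat) *\<^sub>R Y" and "Y \<noteq> 0"
  obtains p where "p \<in> prim_idem" "Y \<circ>\<^sub>J p = 0" "Z \<circ>\<^sub>J p = 0"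
proof -
  obtain h d e f where h: "h \<in> der_group" "h Y = Diag d e f" by (rule spectral)
  obtain h' where h': "h' \<in> der_group" "\<And>X. h' (h X) = X" "\<And>X. h (h' X) = X"
    by (rule der_group_inverse[OF h(1)]) blast
  note lin = der_group_linear[OF h(1)] and lin' = der_group_linear[OF h'(1)]
  obtain a b c x y z where Z: "h Z = hm a b c x y z" by (rule hm_cases)
  have inv: "h W \<bullet> unit_mat = W \<bullet> unit_mat" for W
    using der_group_inner[OF h(1), of W unit_mat] by (simp add: der_group_unit[OF h(1)])
  have "h Y \<circ>\<^sub>J h Y - h Z \<circ>\<^sub>J h Z = (h Y \<bullet> unit_mat) *\<^sub>R h Y - (h Z \<bullet> unit_mat) *\<^sub>R h Z"
    using arg_cong[OF sq, of h] by (simp add: inv linear_diff[OF lin] linear_scale[OF lin] der_group_jordan[OF h(1)])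
  moreover have "2 *\<^sub>R (h Y \<circ>\<^sub>J h Z) = (h Y \<bullet> unit_mat) *\<^sub>R h Z + (h Z \<bullet> unit_mat) *\<^sub>R h Y"
    using arg_cong[OF pr, of h] by (simp add: inv linear_add[OF lin] linear_scale[OF lin] der_group_jordan[OF h(1)])
  moreover have "h Y \<noteq> 0" using \<open>Y \<noteq> 0\<close> h'(2) linear_0[OF lin'] by metis
  ultimately obtain p where p: "p \<in> prim_idem" "h Y \<circ>\<^sub>J p = 0" "h Z \<circ>\<^sub>J p = 0"
    by (rule null_idem_diag[OF h(2)[unfolded Diag_hm] Z]) blast
  have "h' (h W \<circ>\<^sub>J p) = W \<circ>\<^sub>J h' p" for W
    by (simp add: der_group_jordan[OF h'(1)] h'(2))
  then show ?thesis
    using that[of "h' p"] p der_group_prim_idem[OF h'(1)] linear_0[OF lin'] by metis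
qed

lemma null_idem:
  fixes Y Z :: "'a::comp_alg herm"
  assumes sq: "Y \<circ>\<^sub>J Y - Z \<circ>\<^sub>J Z = (Y \<bullet> unit_mat) *\<^sub>R Y - (Z \<bullet> unit_mat) *\<^sub>R Z"
    and pr: "2 *\<^sub>R (Y \<circ>\<^sub>J Z) = (Y \<bullet> unit_mat) *\<^sub>R Z + (Z \<bullet> unit_mat) *\<^sub>R Y" and "Y \<noteq> 0 \<or> Z \<noteq> 0"
  obtains p where "p \<in> prim_idem" "Y \<circ>\<^sub>J p = 0" "Z \<circ>\<^sub>J p = 0"
proof (cases "Y = 0")
  case False
  then show ?thesis using null_idem_nonzero[OF sq pr] that by blast
next
  case True
  then have "Z \<noteq> 0" using assms(3) by simp
  \<comment> \<open>Multiplying u by -\<i> lets \<open>Z\<close> take the place of \<open>Y\<close>,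
    with partner 0.\<close>
  moreover have "Z \<circ>\<^sub>J Z - 0 \<circ>\<^sub>J 0 = (Z \<bullet> unit_mat) *\<^sub>R Z - (0 \<bullet> unit_mat) *\<^sub>R 0"
    using sq True by (simp add: jordan_bilin)
  moreover have "2 *\<^sub>R (Z \<circ>\<^sub>J 0) = (Z \<bullet> unit_mat) *\<^sub>R 0 + (0 \<bullet> unit_mat) *\<^sub>R Z"
    by (simp add: jordan_bilin)
  ultimately obtain p where "p \<in> prim_idem" "Z \<circ>\<^sub>J p = 0"
    using null_idem_nonzero[of Z 0] by blast
  then show ?thesis using True by (intro that[of p]) (simp_all add: jordan_bilin)
qed

lemma image_in_Sigma_bd:
  fixes g :: "'a::comp_alg hermC \<Rightarrow> 'a hermC"
  assumes g: "g \<in> G_hat" and u: "g base_vec = (Y, Z)"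
  shows "Y \<circ>\<^sub>J Y + Z \<circ>\<^sub>J Z \<in> Sigma_bd"
proof -
  \<comment> \<open>Since \<open>g\<close> need not fix the unit, \<open>ctrip_base\<close> is used
    at the preimage of the unit: \<open>g\<close> turns {e v e} into {u 1 u} = u^2, and isometry
    turns the coefficient into the trace of u.\<close>
  obtain v where v: "g v = (unit_mat, 0)"
    using G_hat_bij[OF g] by (metis bij_pointE)
  have i: "g (scaleC \<i> v) = (0, unit_mat)"
    using G_hat_scaleC[OF g, of \<i> v] by (simp add: v scaleC_def)
  have "base_vec \<bullet> v = Y \<bullet> unit_mat" "base_vec \<bullet> scaleC \<i> v = Z \<bullet> unit_mat"
    using G_hat_inner[OF g, of base_vec v] G_hat_inner[OF g, of base_vec "scaleC \<i> v"] by (simp_all add: v i u)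
  then have "ctrip (Y, Z) (unit_mat, 0) (Y, Z) = scaleC (Complex (Y \<bullet> unit_mat) (Z \<bullet> unit_mat)) (Y, Z)"
    using arg_cong[OF ctrip_base[of v], of g] by (simp add: G_hat_ctrip[OF g] G_hat_scaleC[OF g] u v)
  moreover have "jtrip a unit_mat b = a \<circ>\<^sub>J b" "jtrip a 0 b = 0" for a b :: "'a herm"
    by (simp_all add: jtrip_def jordan_bilin jordan_commute[of _ unit_mat] jordan_unit jordan_commute[of b a])
  ultimately have "Y \<circ>\<^sub>J Y - Z \<circ>\<^sub>J Z = (Y \<bullet> unit_mat) *\<^sub>R Y - (Z \<bullet> unit_mat) *\<^sub>R Z"
    "2 *\<^sub>R (Y \<circ>\<^sub>J Z) = (Y \<bullet> unit_mat) *\<^sub>R Z + (Z \<bullet> unit_mat) *\<^sub>R Y"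
    by (simp_all add: ctrip_jtrip scaleC_def scaleR_2 jordan_commute[of Z Y])
  moreover have "Y \<noteq> 0 \<or> Z \<noteq> 0"
    using sigma_map_eq(2)[OF g u] by (auto simp: jordan_bilin)
  ultimately obtain p where p: "p \<in> prim_idem" "Y \<circ>\<^sub>J p = 0" "Z \<circ>\<^sub>J p = 0"
    by (rule null_idem) blast
  then have pp: "p \<circ>\<^sub>J p = p" "unit_mat \<bullet> p = 1" by (simp_all add: prim_idem_def inner_commute)
  \<comment> \<open>\<open>p\<close> is itself a square and pairs to 1 with the unit, so it detects
    every subtraction of a positive multiple of the unit.\<close>
  have "(Y \<circ>\<^sub>J Y + Z \<circ>\<^sub>J Z) \<bullet> p = 0"
    by (simp add: inner_add_left inner_jordan p)
  then have "\<not> psd (Y \<circ>\<^sub>J Y + Z \<circ>\<^sub>J Z - \<epsilon> *\<^sub>R unit_mat)" if "\<epsilon> > 0" for \<epsilon>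
    using that pp unfolding psd_def by (metis diff_0 inner_diff_left inner_scaleR_left mult.right_neutral neg_0_le_iff_le not_le)
  then show ?thesis
    using sigma_map_eq(2)[OF g u] psd_scale_add(2)[OF psd_square psd_square] by (auto simp: Sigma_bd_iff)
qed

lemma Sigma_bd_in_image:
  fixes X :: "'a::comp_alg herm"
  assumes "X \<in> Sigma_bd"
  obtains g Y Z where "g \<in> G_hat" "g base_vec = (Y, Z)" "X = Y \<circ>\<^sub>J Y + Z \<circ>\<^sub>J Z"
proof -
  obtain h \<theta> where h: "h \<in> der_group" "h X = Diag ((cos \<theta>)\<^sup>2) ((sin \<theta>)\<^sup>2) 0"
    using Sigma_bd_conj[OF assms] .
  obtain h' where h': "h' \<in> der_group" "\<And>X. h' (h X) = X" "\<And>X. h (h' X) = X"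
    by (rule der_group_inverse[OF h(1)]) blast
  let ?F = "hm 0 0 0 0 0 1 :: 'a herm"
  let ?T = "\<lambda>u. cextend (\<lambda>_. 0) u + iL ((2 * \<theta>) *\<^sub>R ?F) u"
  have "(\<lambda>_. 0) \<in> jordan_der" by (simp add: jordan_der_def jordan_bilin linear_zero)
  moreover have "(2 * \<theta>) *\<^sub>R ?F \<in> trace_slice 0" by (simp add: trace_slice_iff Diag_hm inner_hm)
  ultimately have T: "?T \<in> lie_hat" unfolding lie_hat_def by blast
  let ?a = "(hm 1 0 0 0 0 0, 0) :: 'a hermC" and ?b = "(hm 0 1 0 0 0 0, 0) :: 'a hermC" and ?c = "(0, ?F)"
  \<comment> \<open>The matrix v v^T, without conjugation, for v = (cos, \<i> sin, 0) at angle t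
    \<theta>. It moves by A v v^T + v v^T A with A = \<i> \<theta> F, which explains the factor 2 in
    \<open>?T\<close>.\<close>
  let ?\<gamma> = "\<lambda>t. (cos (t * \<theta>))\<^sup>2 *\<^sub>R ?a + (- (sin (t * \<theta>))\<^sup>2) *\<^sub>R ?b + (sin (t * \<theta>) * cos (t * \<theta>)) *\<^sub>R ?c"
  have "(?\<gamma> has_vector_derivative ?T (?\<gamma> t)) (at t)" for t
  proof -
    have "?T (?\<gamma> t) = (- 2 * \<theta> * sin (t * \<theta>) * cos (t * \<theta>)) *\<^sub>R ?a + (- 2 * \<theta> * sin (t * \<theta>) * cos (t * \<theta>)) *\<^sub>R ?b
        + (\<theta> * ((cos (t * \<theta>))\<^sup>2 - (sin (t * \<theta>))\<^sup>2)) *\<^sub>R ?c"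
      by (simp add: cextend_def iL_def scaleC_def jordan_hm hm_arith)
    moreover have "(?\<gamma> has_vector_derivative \<dots>) (at t)"
      unfolding power2_eq_square by (rule derivative_eq_intros refl | simp add: algebra_simps)+
    ultimately show ?thesis by simp
  qed
  then have "op_exp ?T (?\<gamma> 0) = ?\<gamma> 1" by (rule op_exp_curve[OF lie_hat_linear[OF T]])
  let ?Y = "hm ((cos \<theta>)\<^sup>2) (- (sin \<theta>)\<^sup>2) 0 0 0 0 :: 'a herm" and ?Z = "hm 0 0 0 0 0 ((sin \<theta> * cos \<theta>) *\<^sub>R 1) :: 'a herm"
  have "op_exp ?T base_vec = (?Y, ?Z)"
    using \<open>op_exp ?T (?\<gamma> 0) = ?\<gamma> 1\<close> by (simp add: Diag_hm hm_arith)
  then have "(cextend h' \<circ> op_exp ?T) base_vec = (h' ?Y, h' ?Z)" by (simp add: cextend_def)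
  moreover have "cextend h' \<circ> op_exp ?T \<in> G_hat"
    using G_hat_comp[OF der_group_G_hat[OF h'(1)] G_hat_exp[OF T G_hat_id]] by simp
  moreover have "X = h' ?Y \<circ>\<^sub>J h' ?Y + h' ?Z \<circ>\<^sub>J h' ?Z"
  proof -
    have poly: "r\<^sup>2 * r\<^sup>2 + (s * r) * (s * r) = r\<^sup>2 * (s\<^sup>2 + r\<^sup>2)"
      "s\<^sup>2 * s\<^sup>2 + (s * r) * (s * r) = s\<^sup>2 * (s\<^sup>2 + r\<^sup>2)" for r s :: real
      by (simp_all add: power2_eq_square algebra_simps)
    have "?Y \<circ>\<^sub>J ?Y + ?Z \<circ>\<^sub>J ?Z = h X"
      using poly(1)[of "cos \<theta>" "sin \<theta>"] poly(2)[of "sin \<theta>" "cos \<theta>"]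
      by (simp add: h(2) Diag_hm jordan_hm hm_arith)
    then have "h' (?Y \<circ>\<^sub>J ?Y + ?Z \<circ>\<^sub>J ?Z) = X" by (simp add: h'(2))
    then show ?thesis
      by (simp add: linear_add[OF der_group_linear[OF h'(1)]] der_group_jordan[OF h'(1)])
  qed
  ultimately show ?thesis using that by blast
qed

theorem sigma_map_image:
  "sigma_map ` (PC :: 'a::comp_alg hermC set set) = {X - (1/3) *\<^sub>R unit_mat | X. X \<in> Sigma_bd}"
proof (intro set_eqI iffI)
  fix W :: "'a herm" assume "W \<in> sigma_map ` PC"
  then obtain g where g: "g \<in> G_hat" "W = sigma_map (g ` base_pt)" by (auto simp: PC_def)
  obtain Y Z where u: "g base_vec = (Y, Z)" by fastforce
  show "W \<in> {X - (1/3) *\<^sub>R unit_mat | X. X \<in> Sigma_bd}"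
    using sigma_map_eq(1)[OF g(1) u] image_in_Sigma_bd[OF g(1) u] g(2) by blast
next
  fix W :: "'a herm" assume "W \<in> {X - (1/3) *\<^sub>R unit_mat | X. X \<in> Sigma_bd}"
  then obtain X where X: "X \<in> Sigma_bd" "W = X - (1/3) *\<^sub>R unit_mat" by blast
  obtain g Y Z where g: "g \<in> G_hat" "g base_vec = (Y, Z)" "X = Y \<circ>\<^sub>J Y + Z \<circ>\<^sub>J Z"
    by (rule Sigma_bd_in_image[OF X(1)])
  have "g ` base_pt \<in> PC" using g(1) by (auto simp: PC_def)
  moreover have "W = sigma_map (g ` base_pt)" using sigma_map_eq(1)[OF g(1,2)] X(2) g(3) by simp
  ultimately show "W \<in> sigma_map ` PC" by blast
qed

theorem mainTheorem4:
  "sigma_map ` (PC :: real hermC set set) = {X - (1/3) *\<^sub>R unit_mat | X. X \<in> Sigma_bd} \<and>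
   sigma_map ` (PC :: complex hermC set set) = {X - (1/3) *\<^sub>R unit_mat | X. X \<in> Sigma_bd} \<and>
   sigma_map ` (PC :: quaternion hermC set set) = {X - (1/3) *\<^sub>R unit_mat | X. X \<in> Sigma_bd} \<and>
   sigma_map ` (PC :: octonion hermC set set) = {X - (1/3) *\<^sub>R unit_mat | X. X \<in> Sigma_bd}"
  by (intro conjI sigma_map_image)

end
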